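(* Let $G=(V,E)$ be a finite, simple, undirected, connected graph with a non-empty boundary vertex set $B\subseteq V$. For a weight $w\in\mathbb{R}_{+}^{|E|}$ consider the two assertions: (1) all Steklov eigenvalues of $(G,B,w)$ are simple; (2) every Steklov eigenfunction of $(G,B,w)$ does not vanish on $B$, i.e. $f(x)\neq 0$ for every Steklov eigenfunction $f\in\mathbb{R}^B$ and every $x\in B$. Then: (i) Assertion (2) implies assertion (1), since if an eigenspace has dimension greater than one, then a suitable linear combination of eigenfunctions in this eigenspace vanishes at a prescribed boundary vertex. (ii) The set of exceptional weights, i.e. of those $w\in\mathbb{R}_{+}^{|E|}$ for which assertions (1) and (2) do not both hold, is contained in the zero set of a non-identically zero polynomial (in the edge weights), and hence is of Hausdorff dimension at most $|E|-1$.
   Context: $\mathbb{R}_{+}$ denotes the set of positive real numbers. A weight is a function $w:E\to\mathbb{R}_{+}$, identified with a point of $\mathbb{R}_{+}^{|E|}$; $w(x,y)$ is the weight of the edge $\{x,y\}$. Put $B^c=V\setminus B$. For $u\in\mathbb{R}^V$ and $x\in V$ set $(\Delta u)(x)=\sum_{y:\{x,y\}\in E}w(x,y)(u(x)-u(y))$, and for $x\in B$ set $(\partial_\nu u)(x)=\sum_{y:\{x,y\}\in E}w(x,y)(u(x)-u(y))$. For $f\in\mathbb{R}^B$, the harmonic extension $h_f\in\mathbb{R}^V$ is the unique function with $h_f|_B=f$ and $(\Delta h_f)(x)=0$ for all $x\in B^c$. The Steklov operator (Dirichlet-to-Neumann map) of $(G,B,w)$ is the linear map $\Lambda:\mathbb{R}^B\to\mathbb{R}^B$,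 $f\mapsto\partial_\nu h_f$. Its eigenvalues are the Steklov eigenvalues and its (nonzero) eigenfunctions $f\in\mathbb{R}^B$ are the Steklov eigenfunctions of $(G,B,w)$. A Steklov eigenvalue is simple if its eigenspace is one-dimensional. *)

theory Defs
  imports "HOL-Analysis.Analysis" "HOL-Library.Poly_Mapping"
begin

section \<open>Graphs and weights\<close>

text \<open>
  The vertex set is the finite type \<open>'v\<close>; edges are unordered pairs, i.e. two-element vertex sets.
\<close>

definition simple_graph :: "'v set set \<Rightarrow> bool" where
  "simple_graph E \<longleftrightarrow> (\<forall>e\<in>E. card e = 2)"

definition connected_graph :: "'v set set \<Rightarrow> bool" where
  "connected_graph E \<longleftrightarrow> (\<forall>x y. (x, y) \<in> {(x, y). {x, y} \<in> E}\<^sup>*)"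

text \<open>
  For a subset \<open>S\<close> of a finite type, the space of real functions on \<open>S\<close> is the coordinate
  subspace of vectors supported on \<open>S\<close>. It is isometric to Euclidean space of dimension
  \<open>card S\<close>, also when \<open>S\<close> is empty. It is used for functions on \<open>B\<close> and on the edge set.
\<close>

definition functions_on :: "'i::finite set \<Rightarrow> (real ^ 'i) set" where
  "functions_on S = {f. \<forall>i. i \<notin> S \<longrightarrow> f $ i = 0}"

definition weights :: "'v::finite set set \<Rightarrow> (real ^ 'v set) set" where
  "weights E = {w \<in> functions_on E. \<forall>e\<in>E. 0 < w $ e}"


section \<open>The Steklov operator\<close>

definition laplacian :: "'v::finite set set \<Rightarrow> real ^ 'v set \<Rightarrow> real ^ 'v \<Rightarrow> real ^ 'v" where
  "laplacian E w u = (\<chi> x. \<Sum>y | {x, y} \<in> E. w $ {x, y} * (u $ x - u $ y))"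

definition normal_derivative ::
    "'v::finite set set \<Rightarrow> 'v set \<Rightarrow> real ^ 'v set \<Rightarrow> real ^ 'v \<Rightarrow> real ^ 'v" where
  "normal_derivative E B w u =
     (\<chi> x. if x \<in> B then \<Sum>y | {x, y} \<in> E. w $ {x, y} * (u $ x - u $ y) else 0)"

definition harmonic_extension ::
    "'v::finite set set \<Rightarrow> 'v set \<Rightarrow> real ^ 'v set \<Rightarrow> real ^ 'v \<Rightarrow> real ^ 'v" where
  "harmonic_extension E B w f =
     (THE h. (\<forall>x\<in>B. h $ x = f $ x) \<and> (\<forall>x\<in>- B. laplacian E w h $ x = 0))"

definition steklov_operator ::
    "'v::finite set set \<Rightarrow> 'v set \<Rightarrow> real ^ 'v set \<Rightarrow> real ^ 'v \<Rightarrow> real ^ 'v" where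
  "steklov_operator E B w f = normal_derivative E B w (harmonic_extension E B w f)"

definition steklov_eigenspace ::
    "'v::finite set set \<Rightarrow> 'v set \<Rightarrow> real ^ 'v set \<Rightarrow> real \<Rightarrow> (real ^ 'v) set" where
  "steklov_eigenspace E B w \<mu> = {f \<in> functions_on B. steklov_operator E B w f = \<mu> *\<^sub>R f}"

definition steklov_eigenvalue ::
    "'v::finite set set \<Rightarrow> 'v set \<Rightarrow> real ^ 'v set \<Rightarrow> real \<Rightarrow> bool" where
  "steklov_eigenvalue E B w \<mu> \<longleftrightarrow> (\<exists>f \<in> steklov_eigenspace E B w \<mu>. f \<noteq> 0)"

definition steklov_eigenfunction ::
    "'v::finite set set \<Rightarrow> 'v set \<Rightarrow> real ^ 'v set \<Rightarrow> real ^ 'v \<Rightarrow> bool" where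
  "steklov_eigenfunction E B w f \<longleftrightarrow> f \<noteq> 0 \<and> (\<exists>\<mu>. f \<in> steklov_eigenspace E B w \<mu>)"

definition all_eigenvalues_simple ::
    "'v::finite set set \<Rightarrow> 'v set \<Rightarrow> real ^ 'v set \<Rightarrow> bool" where
  "all_eigenvalues_simple E B w \<longleftrightarrow>
     (\<forall>\<mu>. steklov_eigenvalue E B w \<mu> \<longrightarrow> dim (steklov_eigenspace E B w \<mu>) = 1)"

definition eigenfunctions_nonvanishing ::
    "'v::finite set set \<Rightarrow> 'v set \<Rightarrow> real ^ 'v set \<Rightarrow> bool" where
  "eigenfunctions_nonvanishing E B w \<longleftrightarrow>
     (\<forall>f. steklov_eigenfunction E B w f \<longrightarrow> (\<forall>x\<in>B. f $ x \<noteq> 0))"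

definition exceptional_weights :: "'v::finite set set \<Rightarrow> 'v set \<Rightarrow> (real ^ 'v set) set" where
  "exceptional_weights E B =
     {w \<in> weights E. \<not> (all_eigenvalues_simple E B w \<and> eigenfunctions_nonvanishing E B w)}"


section \<open>Multivariate polynomials\<close>

text \<open>Finitely supported maps from monomials (exponent maps) to coefficients.\<close>

type_synonym 'i real_mpoly = "('i \<Rightarrow>\<^sub>0 nat) \<Rightarrow>\<^sub>0 real"

definition mpoly_vars :: "'i real_mpoly \<Rightarrow> 'i set" where
  "mpoly_vars p = (\<Union>m \<in> Poly_Mapping.keys p. Poly_Mapping.keys m)"

definition mpoly_eval :: "'i::finite real_mpoly \<Rightarrow> real ^ 'i \<Rightarrow> real" where
  "mpoly_eval p x =
     (\<Sum>m \<in> Poly_Mapping.keys p. Poly_Mapping.lookup p m *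
        (\<Prod>i \<in> Poly_Mapping.keys m. (x $ i) ^ Poly_Mapping.lookup m i))"


section \<open>Hausdorff dimension\<close>

text \<open>
  The case \<open>s = 0\<close> is separate because \<open>0 powr 0 = 0\<close>, whereas a singleton must have
  zero-dimensional measure 1.
\<close>

definition hausdorff_gauge :: "real \<Rightarrow> 'a::metric_space set \<Rightarrow> ennreal" where
  "hausdorff_gauge s U =
     (if U = {} then 0 else if s = 0 then 1 else ennreal (diameter U powr s))"

text \<open>Boundedness is explicit because \<open>diameter\<close> is unspecified on unbounded sets.\<close>

definition hausdorff_premeasure :: "real \<Rightarrow> real \<Rightarrow> 'a::metric_space set \<Rightarrow> ennreal" where
  "hausdorff_premeasure s \<delta> A =
     (INF U \<in> {U :: nat \<Rightarrow> 'a set. A \<subseteq> (\<Union>i. U i) \<and> (\<forall>i. bounded (U i) \<and> diameter (U i) \<le> \<delta>)}.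
        suminf (\<lambda>i. hausdorff_gauge s (U i)))"

definition hausdorff_measure :: "real \<Rightarrow> 'a::metric_space set \<Rightarrow> ennreal" where
  "hausdorff_measure s A = (SUP \<delta> \<in> {0<..}. hausdorff_premeasure s \<delta> A)"

text \<open>
  The convention that the empty set has dimension \<open>-\<infinity>\<close> only matters for bounds by a negative
  number, i.e. for the graph without edges.
\<close>

definition hausdorff_dim :: "'a::metric_space set \<Rightarrow> ereal" where
  "hausdorff_dim A =
     (if A = {} then -\<infinity> else Inf {ereal s | s. 0 \<le> s \<and> hausdorff_measure s A = 0})"

end

theory Submission imports Defs begin

text \<open>
  If an eigenfunction \<open>f\<close> of the self-adjoint operator \<open>\<Lambda>\<close> vanishes at \<open>x \<in> B\<close>, then it is orthogonal to
  the Krylov vectors \<open>\<Lambda>\<^sup>j e\<^sub>x\<close>, so their Gram matrix is singular. By Cramer's rule \<open>\<Lambda>\<close> times a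
  determinant is polynomial in the weight, and so is the determinant of the Gram matrix.

  It remains to find, for each \<open>x\<close>, one nonnegative weight at which no eigenfunction vanishes at \<open>x\<close>.
  Take a spanning tree rooted at \<open>x\<close>, and build it by hanging a rooted tree \<open>T\<close> on the root of
  another tree \<open>S\<close>. An eigenfunction vanishing at \<open>x\<close> restricts to Dirichlet eigenfunctions on
  \<open>S - {x}\<close> and on \<open>T\<close>. Scaling the weights on \<open>T\<close> makes the two finite Dirichlet spectra disjoint,
  hence one of the restrictions is zero, and then induction shows that so is the other.

  For the Hausdorff dimension, the zeros of a polynomial \<open>f\<close> at which some partial derivative
  \<open>\<partial>\<^sub>i f\<close> is not zero locally form a Lipschitz graph over the other coordinates; the remaining zeros
  are zeros of \<open>\<partial>\<^sub>i f\<close>, which has smaller degree.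
\<close>

subsection \<open>Weighted Laplacians\<close>

text \<open>Pairs outside \<open>E\<close> have weight zero, so from here on the graph enters only
  through the support of \<open>w\<close>.\<close>

lemma laplacian_eq_UNIV:
  assumes "w \<in> functions_on E"
  shows "laplacian E w = laplacian UNIV w"
proof (intro ext, simp add: laplacian_def vec_eq_iff, intro allI)
  fix u :: "real^'a" and x :: 'a
  show "(\<Sum>y | {x, y} \<in> E. w $ {x, y} * (u $ x - u $ y)) = (\<Sum>y\<in>UNIV. w $ {x, y} * (u $ x - u $ y))"
    using assms by (intro sum.mono_neutral_left) (auto simp: functions_on_def)
qed

lemma laplacian_UNIV_nth:
  "laplacian UNIV w u $ x = (\<Sum>y\<in>UNIV. w $ {x, y} * (u $ x - u $ y))"
  by (simp add: laplacian_def)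

lemma linear_laplacian: "linear (laplacian E w)"
  by (rule linearI)
     (auto simp: laplacian_def vec_eq_iff sum.distrib[symmetric] sum_distrib_left algebra_simps intro!: sum.cong)

lemma laplacian_add_weight: "laplacian E (w + w') u = laplacian E w u + laplacian E w' u"
  by (simp add: laplacian_def vec_eq_iff sum.distrib[symmetric] algebra_simps)

lemma laplacian_scale_weight: "laplacian E (c *\<^sub>R w) u = c *\<^sub>R laplacian E w u"
  by (simp add: laplacian_def vec_eq_iff sum_distrib_left algebra_simps)

text \<open>Green's formula: the double sum is averaged with its copy under exchange of
  \<open>x\<close> and \<open>y\<close>. It gives symmetry and, for nonnegative weights, a
  nonnegative energy.\<close>

lemma inner_laplacian_UNIV:
  fixes u v :: "real^'v::finite"
  shows "u \<bullet> laplacian UNIV w v = (\<Sum>x\<in>UNIV. \<Sum>y\<in>UNIV. w $ {x, y} * (u $ x - u $ y) * (v $ x - v $ y)) / 2"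
proof -
  have 1: "u \<bullet> laplacian UNIV w v = (\<Sum>x\<in>UNIV. \<Sum>y\<in>UNIV. w $ {x, y} * u $ x * (v $ x - v $ y))"
    by (simp add: inner_vec_def laplacian_def sum_distrib_left algebra_simps)
  also have "\<dots> = (\<Sum>x\<in>UNIV. \<Sum>y\<in>UNIV. w $ {y, x} * u $ y * (v $ y - v $ x))"
    by (rule sum.swap)
  finally have 2: "u \<bullet> laplacian UNIV w v = (\<Sum>x\<in>UNIV. \<Sum>y\<in>UNIV. w $ {x, y} * u $ y * (v $ y - v $ x))"
    by (simp add: insert_commute)
  have "u \<bullet> laplacian UNIV w v + u \<bullet> laplacian UNIV w v =
      (\<Sum>x\<in>UNIV. \<Sum>y\<in>UNIV. w $ {x, y} * (u $ x - u $ y) * (v $ x - v $ y))"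
    by (subst 1, subst 2) (simp add: sum.distrib[symmetric] algebra_simps)
  then show ?thesis by simp
qed

lemma laplacian_energy_zero:
  fixes u :: "real^'v::finite"
  assumes w: "\<And>e. 0 \<le> w $ e" and "u \<bullet> laplacian UNIV w u = 0"
  shows "w $ {x, y} * (u $ x - u $ y) = 0"
proof -
  have "(\<Sum>x\<in>UNIV. \<Sum>y\<in>UNIV. w $ {x, y} * (u $ x - u $ y) * (u $ x - u $ y)) = 0"
    using assms(2) by (simp add: inner_laplacian_UNIV)
  then have "\<forall>x. (\<Sum>y\<in>UNIV. w $ {x, y} * (u $ x - u $ y) * (u $ x - u $ y)) = 0"
    using w by (subst (asm) sum_nonneg_eq_0_iff) (auto intro!: sum_nonneg simp: mult.assoc)
  then have "w $ {x, y} * (u $ x - u $ y) * (u $ x - u $ y) = 0" for x y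
    using w by (simp add: sum_nonneg_eq_0_iff mult.assoc)
  then show ?thesis by auto
qed

text \<open>The determinant of \<open>A - \<mu> J\<close> is a polynomial in \<mu>, nonzero at 0
  since \<open>A\<close> is injective. \<open>J\<close> may be singular: below it cuts down to
  boundary vertices, where alone the eigenvalue occurs.\<close>

lemma finite_pencil_eigenvalues:
  fixes A J :: "real^'n::finite \<Rightarrow> real^'n"
  assumes A: "linear A" and J: "linear J" and inj: "\<And>h. A h = 0 \<Longrightarrow> h = 0"
  shows "finite {\<mu>. \<exists>h. h \<noteq> 0 \<and> A h = \<mu> *\<^sub>R J h}"
proof -
  define M where "M \<mu> = matrix (\<lambda>h. A h - \<mu> *\<^sub>R J h)" for \<mu> :: real
  have lin: "linear (\<lambda>h. A h - \<mu> *\<^sub>R J h)" for \<mu>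
    using A J by (intro linear_compose_sub linear_compose_scale_right)
  have "real_polynomial_function (\<lambda>\<mu>. M \<mu> $ i $ j)" for i j
    by (simp add: M_def matrix_def) (intro real_polynomial_function_diff real_polynomial_function.intros bounded_linear_ident)
  then have "real_polynomial_function (\<lambda>\<mu>. det (M \<mu>))"
    unfolding det_def
    by (intro real_polynomial_function_sum real_polynomial_function.intros(4) real_polynomial_function_prod
        real_polynomial_function.intros(2)) auto
  then obtain c n where c: "(\<lambda>\<mu>. det (M \<mu>)) = (\<lambda>\<mu>. \<Sum>i\<le>n. c i * \<mu> ^ i)"
    using real_polynomial_function_iff_sum by blast
  have det: "det (M \<mu>) \<noteq> 0 \<longleftrightarrow> (\<forall>h. A h - \<mu> *\<^sub>R J h = 0 \<longrightarrow> h = 0)" for \<mu>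
    unfolding M_def using det_nz_iff_inj[OF lin] linear_injective_0[OF lin] by auto
  have "det (M 0) \<noteq> 0"
    using inj by (simp add: det)
  then have "\<exists>i\<le>n. c i \<noteq> 0"
    using fun_cong[OF c, of 0] by (auto simp: sum.neutral)
  then have "finite {\<mu>. (\<Sum>i\<le>n. c i * \<mu> ^ i) = 0}"
    using Transcendental.polyfun_finite_roots by blast
  moreover have "{\<mu>. \<exists>h. h \<noteq> 0 \<and> A h = \<mu> *\<^sub>R J h} \<subseteq> {\<mu>. (\<Sum>i\<le>n. c i * \<mu> ^ i) = 0}"
    using det fun_cong[OF c] by fastforce
  ultimately show ?thesis
    by (rule finite_subset[rotated])
qed

subsection \<open>Weights without eigenfunctions vanishing at a vertex\<close>

text \<open>Joining at the roots, rather than adding leaves, fits the gluing of weights in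
  \<open>observable_from_join\<close>.\<close>

inductive rooted_subtree :: "'v set set \<Rightarrow> 'v \<Rightarrow> 'v set \<Rightarrow> bool" for E where
  single: "rooted_subtree E x {x}"
| join: "rooted_subtree E x S \<Longrightarrow> rooted_subtree E y T \<Longrightarrow> S \<inter> T = {} \<Longrightarrow> {x, y} \<in> E
    \<Longrightarrow> rooted_subtree E x (S \<union> T)"

lemma root_in: "rooted_subtree E x S \<Longrightarrow> x \<in> S"
  by (induction rule: rooted_subtree.induct) auto

text \<open>The leaf is passed down to whichever of the two joined trees contains \<open>a\<close>,
  until that tree is the single vertex \<open>a\<close>.\<close>

lemma rooted_subtree_add_leaf:
  assumes "rooted_subtree E x S" "a \<in> S" "b \<notin> S" "{a, b} \<in> E"
  shows "rooted_subtree E x (insert b S)"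
  using assms
proof (induction rule: rooted_subtree.induct)
  case (single x)
  then have "rooted_subtree E x ({x} \<union> {b})"
    by (intro rooted_subtree.join[of _ _ _ b] rooted_subtree.single) auto
  then show ?case by (simp add: insert_commute)
next
  case (join x S y T)
  show ?case
  proof (cases "a \<in> S")
    case True
    then have "rooted_subtree E x (insert b S \<union> T)"
      using join by (intro rooted_subtree.join[of _ _ _ y]) auto
    then show ?thesis by simp
  next
    case False
    then have "rooted_subtree E x (S \<union> insert b T)"
      using join by (intro rooted_subtree.join[of _ _ _ y]) auto
    then show ?thesis by simp
  qed
qed

text \<open>A path leaving a subtree of maximal size would supply a leaf to add.\<close>

lemma rooted_spanning_tree:
  fixes E :: "'v::finite set set"
  assumes "connected_graph E"
  shows "rooted_subtree E x UNIV"
proof -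
  define S where "S = (ARG_MAX card S. rooted_subtree E x S)"
  have S: "rooted_subtree E x S" and max: "\<And>T. rooted_subtree E x T \<Longrightarrow> card T \<le> card S"
    unfolding S_def
    using arg_max_nat_lemma[of "rooted_subtree E x" "{x}" card "Suc CARD('v)"] 
    by (auto simp: rooted_subtree.single card_mono less_Suc_eq_le)
  have "y \<in> S" if "(x, y) \<in> {(x, y). {x, y} \<in> E}\<^sup>*" for y
    using that
  proof (induction rule: rtrancl_induct)
    case base
    then show ?case using root_in[OF S] .
  next
    case (step y z)
    show ?case
    proof (rule ccontr)
      assume "z \<notin> S"
      then have "card (insert z S) \<le> card S"
        using step S by (intro max rooted_subtree_add_leaf[where a = y]) auto
      then show False using \<open>z \<notin> S\<close> by (simp add: card_insert_if)
    qed
  qed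
  then have "S = UNIV"
    using assms by (auto simp: connected_graph_def)
  then show ?thesis using S by simp
qed


section \<open>Locality of the Laplacian and Dirichlet spectra\<close>

lemma laplacian_UNIV_outside:
  assumes "\<And>e. w $ e \<noteq> 0 \<Longrightarrow> e \<subseteq> S" "v \<notin> S"
  shows "laplacian UNIV w h $ v = 0"
  unfolding laplacian_UNIV_nth
proof (rule sum.neutral, rule ballI)
  fix y
  show "w $ {v, y} * (h $ v - h $ y) = 0"
    using assms(1)[of "{v, y}"] assms(2) by (cases "w $ {v, y} = 0") auto
qed

lemma laplacian_UNIV_cong:
  assumes "\<And>e. w $ e \<noteq> 0 \<Longrightarrow> e \<subseteq> S" "\<And>v. v \<in> S \<Longrightarrow> h $ v = h' $ v"
  shows "laplacian UNIV w h $ v = laplacian UNIV w h' $ v"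
  unfolding laplacian_UNIV_nth
proof (rule sum.cong[OF refl])
  fix y
  show "w $ {v, y} * (h $ v - h $ y) = w $ {v, y} * (h' $ v - h' $ y)"
    using assms(1)[of "{v, y}"] assms(2)[of v] assms(2)[of y] by (cases "w $ {v, y} = 0") auto
qed

lemma laplacian_single_edge:
  assumes "x \<noteq> y"
  shows "laplacian UNIV (axis {x, y} 1) h $ v =
    (if v = x then h $ x - h $ y else if v = y then h $ y - h $ x else 0)"
proof -
  have "laplacian UNIV (axis {x, y} 1) h $ v =
      (\<Sum>z\<in>UNIV. if z = (if v = x then y else x) then (if v = x \<or> v = y then h $ v - h $ z else 0) else 0)"
    unfolding laplacian_UNIV_nth using assms
    by (intro sum.cong) (auto simp: axis_def doubleton_eq_iff)
  then show ?thesis by (simp add: sum.delta)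
qed

lemma laplacian_eq_0_if_energy_zero:
  fixes u :: "real^'v::finite"
  assumes w: "\<And>e. 0 \<le> w $ e" and "u \<bullet> laplacian UNIV w u = 0"
  shows "laplacian UNIV w u = 0"
  unfolding vec_eq_iff laplacian_UNIV_nth using laplacian_energy_zero[OF assms]
  by (auto simp del: mult_eq_0_iff intro!: sum.neutral)

lemma inner_eq_0_if_complementary:
  fixes u v :: "real^'n::finite"
  assumes "\<And>i. u $ i = 0 \<or> v $ i = 0"
  shows "u \<bullet> v = 0"
  unfolding inner_vec_def using assms by (intro sum.neutral) auto

lemma finite_dirichlet_spectrum:
  fixes w :: "real^'v::finite set"
  assumes inj: "\<And>h. h \<in> functions_on R \<Longrightarrow> (\<forall>v\<in>R. laplacian UNIV w h $ v = 0) \<Longrightarrow> h = 0"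
  shows "finite {\<mu>. \<exists>h\<in>functions_on R. h \<noteq> 0 \<and>
    (\<forall>v\<in>R. laplacian UNIV w h $ v = (if v \<in> B then \<mu> * h $ v else 0))}"
proof -
  \<comment> \<open>The problem on \<open>R\<close> is extended to the whole space: \<open>A\<close>
    is the identity off \<open>R\<close>, so its kernel lies in \<open>functions_on R\<close>, and
    \<open>J\<close> is zero where the equation has no eigenvalue term.\<close>
  define A where "A h = (\<chi> v. if v \<in> R then laplacian UNIV w h $ v else h $ v)" for h :: "real^'v"
  define J where "J h = (\<chi> v. if v \<in> R \<inter> B then h $ v else 0)" for h :: "real^'v"
  have "linear A"
    unfolding A_def
    by (rule linearI) (auto simp: vec_eq_iff linear_add[OF linear_laplacian] linear_scale[OF linear_laplacian])
  moreover have "linear J"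
    unfolding J_def by (rule linearI) (auto simp: vec_eq_iff)
  moreover have "h = 0" if "A h = 0" for h
    using that by (intro inj) (auto simp: A_def functions_on_def vec_eq_iff split: if_splits)
  ultimately have "finite {\<mu>. \<exists>h. h \<noteq> 0 \<and> A h = \<mu> *\<^sub>R J h}"
    by (rule finite_pencil_eigenvalues)
  then show ?thesis
    by (rule finite_subset[rotated]) (auto simp: A_def J_def functions_on_def vec_eq_iff)
qed

text \<open>The last clause is unique continuation from \<open>x\<close>, for eigenfunctions
  replaced by their harmonic extensions. Weights may vanish on edges of \<open>E\<close>, which
  admits weights carried by a tree, and one weight serves all \<mu>.\<close>

definition observable_from :: "'v::finite set set \<Rightarrow> 'v set \<Rightarrow> 'v \<Rightarrow> 'v set \<Rightarrow> real^'v set \<Rightarrow> bool" where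
  "observable_from E B x S w \<longleftrightarrow>
     (\<forall>e. 0 \<le> w $ e) \<and> (\<forall>e. w $ e \<noteq> 0 \<longrightarrow> e \<in> E \<and> e \<subseteq> S) \<and>
     (\<forall>\<mu> h. h $ x = 0 \<longrightarrow> (\<forall>v\<in>S. laplacian UNIV w h $ v = (if v \<in> B then \<mu> * h $ v else 0)) \<longrightarrow>
        (\<forall>v\<in>S. h $ v = 0))"

lemma observable_fromD:
  assumes "observable_from E B x S w"
  shows "0 \<le> w $ e" "w $ e \<noteq> 0 \<Longrightarrow> e \<in> E" "w $ e \<noteq> 0 \<Longrightarrow> e \<subseteq> S"
    "h $ x = 0 \<Longrightarrow> (\<And>v. v \<in> S \<Longrightarrow> laplacian UNIV w h $ v = (if v \<in> B then \<mu> * h $ v else 0))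
      \<Longrightarrow> v \<in> S \<Longrightarrow> h $ v = 0"
  using assms unfolding observable_from_def by blast+

lemma observable_from_harmonic:
  assumes "observable_from E B x S w" "h $ x = 0" "laplacian UNIV w h = 0" "v \<in> S"
  shows "h $ v = 0"
  using observable_fromD(4)[OF assms(1,2), of 0 v] assms(3,4) by simp

text \<open>Only the finitely many quotients of an element of \<open>F\<close> by one of
  \<open>G\<close> must be avoided: if \<open>\<mu> / c\<close> lies in \<open>G\<close>, it is
  nonzero, and \<open>c\<close> is the quotient of \<mu> by it.\<close>

lemma exists_scale_separating_finite_sets:
  fixes F G :: "real set"
  assumes "finite F" "finite G" "0 \<notin> G"
  obtains c where "c > 0" "\<And>\<mu>. \<mu> \<in> F \<Longrightarrow> \<mu> / c \<notin> G"
proof -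
  have "infinite ({0<..} - (\<lambda>(a, b). a / b) ` (F \<times> G))"
    using assms by (intro Diff_infinite_finite infinite_Ioi) auto
  then obtain c where c: "c > 0" "c \<notin> (\<lambda>(a, b). a / b) ` (F \<times> G)"
    using infinite_imp_nonempty by blast
  have "\<mu> / c \<notin> G" if "\<mu> \<in> F" for \<mu>
  proof
    assume G: "\<mu> / c \<in> G"
    then have "c = \<mu> / (\<mu> / c)" using assms(3) c(1) by (cases "\<mu> = 0") auto
    then show False using c(2) that G by force
  qed
  then show ?thesis using that c(1) by blast
qed

lemma observable_from_join:
  fixes E :: "'v::finite set set"
  assumes 1: "observable_from E B x S w\<^sub>1" and 2: "observable_from E B y T w\<^sub>2"
    and xy: "x \<in> S" "y \<in> T" "S \<inter> T = {}" "{x, y} \<in> E"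
  shows "\<exists>w. observable_from E B x (S \<union> T) w"
proof -
  define a :: "real^'v set" where "a = axis {x, y} 1"
  have ne: "x \<noteq> y" using xy by auto
  note La = laplacian_single_edge[OF ne, folded a_def]
  have a: "0 \<le> a $ e" "a $ e \<noteq> 0 \<longleftrightarrow> e = {x, y}" for e
    by (auto simp: a_def axis_def)
  define spec where "spec R w = {\<mu>. \<exists>h\<in>functions_on R. h \<noteq> 0 \<and>
    (\<forall>v\<in>R. laplacian UNIV w h $ v = (if v \<in> B then \<mu> * h $ v else 0))}" for R and w :: "real^'v set"
  \<comment> \<open>Such an \<open>h\<close> vanishes at \<open>x\<close> and has zero energy, hence
    is harmonic at \<open>x\<close> too, and observability from \<open>x\<close> applies.\<close>
  have inj1: "h = 0" if h: "h \<in> functions_on (S - {x})" "\<forall>v\<in>S - {x}. laplacian UNIV w\<^sub>1 h $ v = 0" for h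
  proof -
    have "h \<bullet> laplacian UNIV w\<^sub>1 h = 0"
      using h by (intro inner_eq_0_if_complementary) (auto simp: functions_on_def)
    then have "laplacian UNIV w\<^sub>1 h = 0"
      by (rule laplacian_eq_0_if_energy_zero[OF observable_fromD(1)[OF 1]])
    then have "h $ v = 0" if "v \<in> S" for v
      using observable_from_harmonic[OF 1] h that by (auto simp: functions_on_def)
    then show ?thesis using h(1) by (auto simp: functions_on_def vec_eq_iff)
  qed
  \<comment> \<open>Here \<open>x\<close> lies outside \<open>T\<close> and acts as a Dirichlet
    vertex. The new edge has positive weight, so zero energy forces
    \<open>h $ y = h $ x = 0\<close>; then \<open>h\<close> is harmonic for \<open>w\<^sub>2\<close>
    and vanishes at the root \<open>y\<close>.\<close>
  have inj2: "h = 0" if h: "h \<in> functions_on T" "\<forall>v\<in>T. laplacian UNIV (w\<^sub>2 + a) h $ v = 0" for h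
  proof -
    have E: "h \<bullet> laplacian UNIV (w\<^sub>2 + a) h = 0"
      using h by (intro inner_eq_0_if_complementary) (auto simp: functions_on_def)
    have pos: "0 \<le> (w\<^sub>2 + a) $ e" for e
      using observable_fromD(1)[OF 2, of e] a(1)[of e] by simp
    have zero: "(w\<^sub>2 + a) $ {u, v} * (h $ u - h $ v) = 0" for u v
      using laplacian_energy_zero[OF pos E] .
    have hx: "h $ x = 0" using h(1) xy by (auto simp: functions_on_def)
    moreover have "(w\<^sub>2 + a) $ {x, y} > 0"
      using observable_fromD(1)[OF 2, of "{x,y}"] by (simp add: a_def axis_def)
    ultimately have hy: "h $ y = 0"
      using zero[of x y] by auto
    have "w\<^sub>2 $ {u, v} * (h $ u - h $ v) = 0" for u v
      using zero[of u v] a(2)[of "{u, v}"] hx hy by (cases "a $ {u, v} = 0") (auto simp: doubleton_eq_iff)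
    then have "laplacian UNIV w\<^sub>2 h = 0"
      unfolding vec_eq_iff laplacian_UNIV_nth by (auto simp del: mult_eq_0_iff intro!: sum.neutral)
    then have "h $ v = 0" if "v \<in> T" for v
      using observable_from_harmonic[OF 2] hy that by auto
    then show ?thesis using h(1) by (auto simp: functions_on_def vec_eq_iff)
  qed
  have fin1: "finite (spec (S - {x}) w\<^sub>1)"
    unfolding spec_def by (rule finite_dirichlet_spectrum) (rule inj1)
  have fin2: "finite (spec T (w\<^sub>2 + a))"
    unfolding spec_def by (rule finite_dirichlet_spectrum) (rule inj2)
  have "0 \<notin> spec T (w\<^sub>2 + a)"
    using inj2 by (auto simp: spec_def)
  then obtain c where c: "c > 0" "\<And>\<mu>. \<mu> \<in> spec (S - {x}) w\<^sub>1 \<Longrightarrow> \<mu> / c \<notin> spec T (w\<^sub>2 + a)"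
    using exists_scale_separating_finite_sets[OF fin1 fin2] by blast
  \<comment> \<open>The connecting edge is scaled along with \<open>T\<close>, so an eigenvalue
    \<mu> for \<open>w\<close> appears on \<open>T\<close> as \<open>\<mu> / c\<close> for
    \<open>w\<^sub>2 + a\<close>.\<close>
  define w where "w = w\<^sub>1 + c *\<^sub>R (w\<^sub>2 + a)"
  have Lw: "laplacian UNIV w h $ v = laplacian UNIV w\<^sub>1 h $ v
      + c * (laplacian UNIV w\<^sub>2 h $ v + laplacian UNIV a h $ v)" for h v
    by (simp add: w_def laplacian_add_weight laplacian_scale_weight)
  have out1: "laplacian UNIV w\<^sub>1 h $ v = 0" if "v \<notin> S" for h v
    using observable_fromD(3)[OF 1] that by (rule laplacian_UNIV_outside)
  have out2: "laplacian UNIV w\<^sub>2 h $ v = 0" if "v \<notin> T" for h v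
    using observable_fromD(3)[OF 2] that by (rule laplacian_UNIV_outside)
  have "h $ v = 0"
    if hx: "h $ x = 0" and eq: "\<forall>v\<in>S \<union> T. laplacian UNIV w h $ v = (if v \<in> B then \<mu> * h $ v else 0)"
      and v: "v \<in> S \<union> T" for \<mu> h v
  proof -
    \<comment> \<open>Cutting leaves the relevant Laplacians unchanged: \<open>w\<^sub>1\<close>
      lives on \<open>S\<close>, and \<open>w\<^sub>2 + a\<close> on \<open>T\<close> together with
      \<open>x\<close>, where \<open>h\<close> vanishes.\<close>
    define h\<^sub>1 where "h\<^sub>1 = (\<chi> v. if v \<in> S then h $ v else 0)"
    define h\<^sub>2 where "h\<^sub>2 = (\<chi> v. if v \<in> T then h $ v else 0)"
    have L1: "laplacian UNIV w\<^sub>1 h\<^sub>1 $ v = laplacian UNIV w\<^sub>1 h $ v" for v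
      using observable_fromD(3)[OF 1] by (rule laplacian_UNIV_cong) (auto simp: h\<^sub>1_def)
    have "(w\<^sub>2 + a) $ e \<noteq> 0 \<Longrightarrow> e \<subseteq> insert x T" for e
      using observable_fromD(3)[OF 2, of e] a(2)[of e] xy by (cases "w\<^sub>2 $ e = 0") auto
    then have L2: "laplacian UNIV (w\<^sub>2 + a) h\<^sub>2 $ v = laplacian UNIV (w\<^sub>2 + a) h $ v" for v
      by (rule laplacian_UNIV_cong) (auto simp: h\<^sub>2_def hx)
    have eq1: "laplacian UNIV w\<^sub>1 h $ v = (if v \<in> B then \<mu> * h $ v else 0)" if "v \<in> S - {x}" for v
    proof -
      have "v \<notin> T" "v \<noteq> x" "v \<noteq> y" using that xy by auto
      then show ?thesis using bspec[OF eq, of v] that out2[of v h] by (simp add: Lw La)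
    qed
    \<comment> \<open>The eigenvalue term drops out because \<open>h $ x = 0\<close>; the connecting
      edge contributes the flow \<open>c * h $ y\<close>.\<close>
    have eqx: "laplacian UNIV w\<^sub>1 h $ x = c * h $ y"
    proof -
      have "x \<notin> T" using xy by auto
      then show ?thesis using bspec[OF eq, of x] xy(1) out2[of x h] hx by (simp add: Lw La split: if_splits)
    qed
    have eq2: "laplacian UNIV (w\<^sub>2 + a) h $ v = (if v \<in> B then \<mu> / c * h $ v else 0)" if "v \<in> T" for v
    proof -
      have "c * laplacian UNIV (w\<^sub>2 + a) h $ v = (if v \<in> B then \<mu> * h $ v else 0)"
      proof -
        have "v \<notin> S" using that xy by auto
        then show ?thesis using bspec[OF eq, of v] that out1[of v h] by (simp add: Lw laplacian_add_weight)
      qed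
      then show ?thesis using c(1) by (auto simp: field_simps split: if_splits)
    qed
    have "\<mu> \<in> spec (S - {x}) w\<^sub>1" if "h\<^sub>1 \<noteq> 0"
    proof -
      have "h\<^sub>1 \<in> functions_on (S - {x})" using hx by (auto simp: h\<^sub>1_def functions_on_def)
      moreover have "laplacian UNIV w\<^sub>1 h\<^sub>1 $ v = (if v \<in> B then \<mu> * h\<^sub>1 $ v else 0)" if "v \<in> S - {x}" for v
        using eq1[OF that] that by (simp add: L1) (simp add: h\<^sub>1_def)
      ultimately show ?thesis using that unfolding spec_def by blast
    qed
    moreover have "\<mu> / c \<in> spec T (w\<^sub>2 + a)" if "h\<^sub>2 \<noteq> 0"
    proof -
      have "h\<^sub>2 \<in> functions_on T" by (auto simp: h\<^sub>2_def functions_on_def)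
      moreover have "laplacian UNIV (w\<^sub>2 + a) h\<^sub>2 $ v = (if v \<in> B then \<mu> / c * h\<^sub>2 $ v else 0)" if "v \<in> T" for v
        using eq2[OF that] that by (simp add: L2) (simp add: h\<^sub>2_def)
      ultimately show ?thesis using that unfolding spec_def by blast
    qed
    \<comment> \<open>The choice of \<open>c\<close> excludes that \<mu> and
      \<open>\<mu> / c\<close> lie in their respective spectra simultaneously.\<close>
    ultimately have "h\<^sub>1 = 0 \<or> h\<^sub>2 = 0" using c(2) by auto
    then show ?thesis
    proof
      assume "h\<^sub>2 = 0"
      then have T0: "h $ v = 0" if "v \<in> T" for v
        proof -
        have "h\<^sub>2 $ v = 0" using \<open>h\<^sub>2 = 0\<close> by simp
        then show ?thesis using that by (simp add: h\<^sub>2_def)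
      qed
      \<comment> \<open>With \<open>h\<close> zero on \<open>T\<close> nothing flows into
        \<open>x\<close>, so the equation for \<open>w\<^sub>1\<close> holds at \<open>x\<close> as
        well and observability of \<open>S\<close> applies.\<close>
      then have "laplacian UNIV w\<^sub>1 h $ x = 0" using eqx xy by simp
      then have "laplacian UNIV w\<^sub>1 h $ v = (if v \<in> B then \<mu> * h $ v else 0)" if "v \<in> S" for v
        using eq1[of v] that hx by (cases "v = x") auto
      then have "h $ v = 0" if "v \<in> S" for v
        using that by (rule observable_fromD(4)[OF 1 hx])
      then show ?thesis using T0 v by blast
    next
      assume h10: "h\<^sub>1 = 0"
      then have S0: "h $ v = 0" if "v \<in> S" for v
        proof -
        have "h\<^sub>1 $ v = 0" using \<open>h\<^sub>1 = 0\<close> by simp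
        then show ?thesis using that by (simp add: h\<^sub>1_def)
      qed
      have "laplacian UNIV w\<^sub>1 h $ x = 0"
        using L1[of x] by (simp add: h10 linear_0[OF linear_laplacian])
      \<comment> \<open>With \<open>h\<close> zero on \<open>S\<close> nothing can balance the flow
        into \<open>x\<close>, so \<open>h $ y = 0\<close>; the edge then drops out of the equation
        on \<open>T\<close>.\<close>
      then have hy: "h $ y = 0" using eqx c(1) by simp
      have "laplacian UNIV w\<^sub>2 h $ v = (if v \<in> B then \<mu> / c * h $ v else 0)" if "v \<in> T" for v
        using eq2[OF that] hx hy that xy by (auto simp: laplacian_add_weight La split: if_splits)
      then have "h $ v = 0" if "v \<in> T" for v
        using that by (rule observable_fromD(4)[OF 2 hy])
      then show ?thesis using S0 v by blast
    qed
  qed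
  moreover have "0 \<le> w $ e" for e
    using observable_fromD(1)[OF 1, of e] observable_fromD(1)[OF 2, of e] a(1)[of e] c(1)
    by (simp add: w_def)
  moreover have "e \<in> E \<and> e \<subseteq> S \<union> T" if "w $ e \<noteq> 0" for e
  proof -
    have "w\<^sub>1 $ e \<noteq> 0 \<or> w\<^sub>2 $ e \<noteq> 0 \<or> a $ e \<noteq> 0"
      using that by (auto simp: w_def)
    then show ?thesis
      using observable_fromD(2,3)[OF 1, of e] observable_fromD(2,3)[OF 2, of e] a(2)[of e] xy by auto
  qed
  ultimately have "observable_from E B x (S \<union> T) w"
    unfolding observable_from_def by blast
  then show ?thesis ..
qed

lemma observable_weights_exist:
  fixes E :: "'v::finite set set"
  assumes "connected_graph E"
  obtains w where "observable_from E B x UNIV w"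
proof -
  have "\<exists>w. observable_from E B x S w" if "rooted_subtree E x S" for S
    using that
  proof (induction rule: rooted_subtree.induct)
    case (single x)
    \<comment> \<open>On the single vertex \<open>x\<close> the conclusion is
      \<open>h $ x = 0\<close> itself, so the zero weight serves.\<close>
    show ?case by (rule exI[of _ 0]) (auto simp: observable_from_def)
  next
    case (join x S y T)
    then show ?case by (meson observable_from_join root_in)
  qed
  then show ?thesis using that rooted_spanning_tree[OF assms] by blast
qed

subsection \<open>The Steklov operator\<close>

text \<open>Maximise the Rayleigh quotient over the unit sphere of \<open>K\<close> and perturb the
  maximiser within \<open>K\<close>, where symmetry is available.\<close>

lemma symmetric_invariant_subspace_eigenvector:
  fixes T :: "'a::euclidean_space \<Rightarrow> 'a"
  assumes T: "linear T" and K: "subspace K" and inv: "\<And>u. u \<in> K \<Longrightarrow> T u \<in> K"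
    and sym: "\<And>u v. u \<in> K \<Longrightarrow> v \<in> K \<Longrightarrow> u \<bullet> T v = T u \<bullet> v"
    and nz: "k \<in> K" "k \<noteq> 0"
  obtains u \<mu> where "u \<in> K" "u \<noteq> 0" "T u = \<mu> *\<^sub>R u"
proof -
  let ?S = "sphere 0 1 \<inter> K"
  have "compact ?S"
    by (intro compact_Int_closed compact_sphere closed_subspace K)
  moreover have "(1 / norm k) *\<^sub>R k \<in> ?S"
    using nz K by (auto simp: subspace_scale)
  moreover have "continuous_on ?S (\<lambda>u. u \<bullet> T u)"
    using T by (intro continuous_intros linear_continuous_on linear_conv_bounded_linear[THEN iffD1])
  ultimately obtain u where u: "u \<in> ?S" and max: "\<And>v. v \<in> ?S \<Longrightarrow> v \<bullet> T v \<le> u \<bullet> T u"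
    using continuous_attains_sup[of ?S "\<lambda>u. u \<bullet> T u"] by blast
  define M where "M = u \<bullet> T u"
  have bound: "v \<bullet> T v \<le> M * (v \<bullet> v)" if "v \<in> K" for v
  proof (cases "v = 0")
    case False
    then have "((1 / norm v) *\<^sub>R v) \<bullet> T ((1 / norm v) *\<^sub>R v) \<le> M"
      using max[of "(1 / norm v) *\<^sub>R v"] that K by (auto simp: subspace_scale M_def)
    then have "(v \<bullet> T v) / (norm v)\<^sup>2 \<le> M"
      by (simp add: linear_scale[OF T] power2_eq_square)
    then show ?thesis
      using False by (simp add: divide_le_eq power2_norm_eq_inner)
  qed simp
  define r where "r = T u - M *\<^sub>R u"
  have r: "r \<in> K" using u K inv by (auto simp: r_def subspace_diff subspace_scale)
  define C where "C = M * (r \<bullet> r) - r \<bullet> T r"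
  have C: "C \<ge> 0" using bound[OF r] by (simp add: C_def)
  have uu: "u \<bullet> u = 1" using u by (simp add: dot_square_norm)
  \<comment> \<open>Maximality tested at \<open>u + t *\<^sub>R r\<close>, where \<open>r\<close> is
    the residual: first order gain against second order loss.\<close>
  have ineq: "2 * t * (r \<bullet> r) \<le> t\<^sup>2 * C" for t
  proof -
    have "(u + t *\<^sub>R r) \<bullet> T (u + t *\<^sub>R r) \<le> M * ((u + t *\<^sub>R r) \<bullet> (u + t *\<^sub>R r))"
      using u r K by (intro bound) (auto simp: subspace_add subspace_scale)
    moreover have "u \<bullet> T r = r \<bullet> T u"
      using sym[of u r] u r by (simp add: inner_commute)
    moreover have "r \<bullet> T u = r \<bullet> r + M * (r \<bullet> u)"
    proof -
      have "T u = r + M *\<^sub>R u" by (simp add: r_def)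
      then show ?thesis by (simp add: inner_add_right)
    qed
    ultimately show ?thesis
      using uu by (simp add: linear_add[OF T] linear_scale[OF T] inner_add_left inner_add_right
          C_def M_def[symmetric] inner_commute[of u r] power2_eq_square algebra_simps)
  qed
  have "r \<bullet> r = 0"
  proof (rule ccontr)
    assume "r \<bullet> r \<noteq> 0"
    then have pos: "r \<bullet> r > 0" by simp
    \<comment> \<open>The \<open>+ 1\<close> avoids dividing by zero when \<open>C = 0\<close>; with
      this \<open>t\<close> the loss is at most half of the gain.\<close>
    define t where "t = (r \<bullet> r) / (C + 1)"
    have t: "t > 0" using pos C by (simp add: t_def)
    have "t * (2 * (r \<bullet> r)) \<le> t * (t * C)"
      using ineq[of t] by (simp add: power2_eq_square algebra_simps)
    then have "2 * (r \<bullet> r) \<le> t * C" using t by simp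
    also have "\<dots> \<le> t * (C + 1)" using t by simp
    also have "\<dots> = r \<bullet> r" using C by (simp add: t_def)
    finally show False using pos by simp
  qed
  then have "T u = M *\<^sub>R u" by (simp add: r_def)
  moreover have "u \<in> K" "u \<noteq> 0" using u by auto
  ultimately show ?thesis by (rule that[rotated 2])
qed

text \<open>Rows at \<open>B\<close> encode the boundary condition, the other rows harmonicity, so
  the harmonic extension of \<open>f\<close> supported on \<open>B\<close> solves a square system
  with right side \<open>f\<close>.\<close>

definition dirichlet_matrix :: "'v::finite set \<Rightarrow> real^'v set \<Rightarrow> real^'v^'v" where
  "dirichlet_matrix B w = matrix (\<lambda>h. \<chi> v. if v \<in> B then h $ v else laplacian UNIV w h $ v)"

lemma dirichlet_matrix_mult:
  "dirichlet_matrix B w *v h = (\<chi> v. if v \<in> B then h $ v else laplacian UNIV w h $ v)"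
  unfolding dirichlet_matrix_def
proof (rule matrix_works, unfold linear_matrix_vector_mul_eq, rule linearI)
qed (auto simp: vec_eq_iff linear_add[OF linear_laplacian] linear_scale[OF linear_laplacian])

lemma subspace_functions_on: "subspace (functions_on B)"
  by (auto simp: subspace_def functions_on_def)

text \<open>A kernel vector vanishes on \<open>B\<close> and is harmonic off \<open>B\<close>, so it
  has zero energy and is harmonic everywhere. This covers tree weights as well as positive
  ones.\<close>

lemma det_dirichlet_matrix_nonzero:
  fixes w :: "real^'v::finite set"
  assumes w: "\<And>e. 0 \<le> w $ e"
    and inj: "\<And>h. laplacian UNIV w h = 0 \<Longrightarrow> (\<forall>v\<in>B. h $ v = 0) \<Longrightarrow> h = 0"
  shows "det (dirichlet_matrix B w) \<noteq> 0"
proof -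
  have "h = 0" if h: "dirichlet_matrix B w *v h = 0" for h
  proof (rule inj)
    have *: "\<forall>v. (v \<in> B \<longrightarrow> h $ v = 0) \<and> (v \<notin> B \<longrightarrow> laplacian UNIV w h $ v = 0)"
      using h by (auto simp: dirichlet_matrix_mult vec_eq_iff split: if_splits)
    then have "h \<bullet> laplacian UNIV w h = 0"
      by (intro inner_eq_0_if_complementary) auto
    then show "laplacian UNIV w h = 0"
      by (rule laplacian_eq_0_if_energy_zero[OF w])
    show "\<forall>v\<in>B. h $ v = 0" using * by blast
  qed
  then show ?thesis
    using invertible_det_nz[of "dirichlet_matrix B w"] matrix_left_invertible_ker[of "dirichlet_matrix B w"]
      invertible_left_inverse by blast
qed

text \<open>A harmonic function is constant along edges of positive weight, and paths from a
  boundary vertex reach every vertex.\<close>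

lemma det_dirichlet_matrix_weights:
  fixes E :: "'v::finite set set"
  assumes "connected_graph E" "B \<noteq> {}" "w \<in> weights E"
  shows "det (dirichlet_matrix B w) \<noteq> 0"
proof (rule det_dirichlet_matrix_nonzero)
  show w: "0 \<le> w $ e" for e
    using assms(3) by (cases "e \<in> E") (auto simp: weights_def functions_on_def intro: less_imp_le)
  fix h assume h: "laplacian UNIV w h = 0" "\<forall>v\<in>B. h $ v = 0"
  obtain b where b: "b \<in> B" using assms(2) by blast
  have edge: "h $ x = h $ y" if "{x, y} \<in> E" for x y
  proof -
    have "w $ {x, y} * (h $ x - h $ y) = 0"
      using h(1) by (intro laplacian_energy_zero[OF w]) simp
    moreover have "w $ {x, y} > 0" using assms(3) that by (auto simp: weights_def)
    ultimately show ?thesis by simp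
  qed
  have "h $ y = 0" if "(b, y) \<in> {(x, y). {x, y} \<in> E}\<^sup>*" for y
    using that by (induction rule: rtrancl_induct) (use b h(2) edge in auto)
  then show "h = 0" using assms(1) by (auto simp: connected_graph_def vec_eq_iff)
qed

text \<open>\<open>det (dirichlet_matrix B w)\<close> times the harmonic extension, by Cramer's rule; unlike
  the extension itself it is polynomial in the weight.\<close>

definition scaled_extension :: "'v::finite set \<Rightarrow> real^'v set \<Rightarrow> real^'v \<Rightarrow> real^'v" where
  "scaled_extension B w f = (\<chi> k. det (\<chi> i j. if j = k then f $ i else dirichlet_matrix B w $ i $ j))"

text \<open>The Steklov operator with its denominator cleared, and defined even where the
  determinant vanishes.\<close>

definition scaled_steklov :: "'v::finite set \<Rightarrow> real^'v set \<Rightarrow> real^'v \<Rightarrow> real^'v" where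
  "scaled_steklov B w f = (\<chi> x. if x \<in> B then laplacian UNIV w (scaled_extension B w f) $ x else 0)"

lemma scaled_steklov_in: "scaled_steklov B w f \<in> functions_on B"
  by (simp add: scaled_steklov_def functions_on_def)

section \<open>The Steklov operator where the Dirichlet problem is uniquely solvable\<close>

context
  fixes E :: "'v::finite set set" and B :: "'v set" and w :: "real^'v set"
  assumes w: "w \<in> functions_on E" and det: "det (dirichlet_matrix B w) \<noteq> 0"
begin

text \<open>The determinant condition gives uniqueness also for weights that vanish on some
  edges.\<close>

lemma harmonic_extension_eqI:
  assumes "\<forall>x\<in>B. h $ x = f $ x" "\<forall>x\<in>- B. laplacian UNIV w h $ x = 0"
  shows "harmonic_extension E B w f = h"
  unfolding harmonic_extension_def laplacian_eq_UNIV[OF w]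
proof (rule the_equality)
  fix h' assume h': "(\<forall>x\<in>B. h' $ x = f $ x) \<and> (\<forall>x\<in>- B. laplacian UNIV w h' $ x = 0)"
  have "dirichlet_matrix B w *v h' = dirichlet_matrix B w *v h"
    using assms h' by (auto simp: dirichlet_matrix_mult vec_eq_iff)
  then show "h' = h"
    using det invertible_det_nz inj_matrix_vector_mult[of "dirichlet_matrix B w"] by (auto dest: injD)
qed (use assms in auto)

text \<open>Cramer's rule with right side \<open>f\<close>; since \<open>f\<close> vanishes off
  \<open>B\<close>, the rows there say that the solution is harmonic.\<close>

lemma scaled_extension:
  assumes "f \<in> functions_on B"
  shows "scaled_extension B w f = det (dirichlet_matrix B w) *\<^sub>R harmonic_extension E B w f"
    and "x \<in> B \<Longrightarrow> harmonic_extension E B w f $ x = f $ x"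
    and "x \<notin> B \<Longrightarrow> laplacian UNIV w (harmonic_extension E B w f) $ x = 0"
proof -
  let ?h = "(1 / det (dirichlet_matrix B w)) *\<^sub>R scaled_extension B w f"
  have "dirichlet_matrix B w *v ?h = f"
    unfolding cramer[OF det] by (simp add: scaled_extension_def vec_eq_iff)
  then have h: "\<forall>x. (x \<in> B \<longrightarrow> ?h $ x = f $ x) \<and> (x \<notin> B \<longrightarrow> laplacian UNIV w ?h $ x = f $ x)"
    by (auto simp: dirichlet_matrix_mult vec_eq_iff split: if_splits)
  have eq: "harmonic_extension E B w f = ?h"
    by (rule harmonic_extension_eqI) (use h assms in \<open>auto simp: functions_on_def\<close>)
  show "scaled_extension B w f = det (dirichlet_matrix B w) *\<^sub>R harmonic_extension E B w f"
    unfolding eq using det by simp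
  show "x \<in> B \<Longrightarrow> harmonic_extension E B w f $ x = f $ x"
    "x \<notin> B \<Longrightarrow> laplacian UNIV w (harmonic_extension E B w f) $ x = 0"
    unfolding eq using h assms by (auto simp: functions_on_def)
qed

lemma steklov_operator_nth:
  "steklov_operator E B w f $ x = (if x \<in> B then laplacian UNIV w (harmonic_extension E B w f) $ x else 0)"
  using fun_cong[OF laplacian_eq_UNIV[OF w]]
  by (simp add: steklov_operator_def normal_derivative_def laplacian_def vec_eq_iff)

lemma scaled_steklov_eq:
  assumes "f \<in> functions_on B"
  shows "scaled_steklov B w f = det (dirichlet_matrix B w) *\<^sub>R steklov_operator E B w f"
  unfolding scaled_steklov_def scaled_extension(1)[OF assms]
  by (simp add: vec_eq_iff steklov_operator_nth linear_scale[OF linear_laplacian])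

lemma steklov_operator_in: "steklov_operator E B w f \<in> functions_on B"
  by (simp add: functions_on_def steklov_operator_nth)

lemma harmonic_extension_lincomb:
  assumes f: "f \<in> functions_on B" and g: "g \<in> functions_on B"
  shows "harmonic_extension E B w (a *\<^sub>R f + b *\<^sub>R g) =
    a *\<^sub>R harmonic_extension E B w f + b *\<^sub>R harmonic_extension E B w g"
  by (rule harmonic_extension_eqI)
     (use scaled_extension(2,3)[OF f] scaled_extension(2,3)[OF g] in
      \<open>auto simp: linear_add[OF linear_laplacian] linear_scale[OF linear_laplacian]\<close>)

lemma steklov_operator_lincomb:
  assumes f: "f \<in> functions_on B" and g: "g \<in> functions_on B"
  shows "steklov_operator E B w (a *\<^sub>R f + b *\<^sub>R g) =
    a *\<^sub>R steklov_operator E B w f + b *\<^sub>R steklov_operator E B w g"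
  by (auto simp: vec_eq_iff steklov_operator_nth harmonic_extension_lincomb[OF f g]
      linear_add[OF linear_laplacian] linear_scale[OF linear_laplacian])

lemma subspace_steklov_eigenspace: "subspace (steklov_eigenspace E B w \<mu>)"
proof -
  have zero: "(0::real^'v) \<in> functions_on B"
    by (simp add: functions_on_def)
  show ?thesis
    unfolding subspace_def steklov_eigenspace_def
  proof (intro conjI ballI allI)
    show "0 \<in> {f \<in> functions_on B. steklov_operator E B w f = \<mu> *\<^sub>R f}"
      using steklov_operator_lincomb[OF zero zero, of 0 0] zero by simp
    fix f g assume f: "f \<in> {f \<in> functions_on B. steklov_operator E B w f = \<mu> *\<^sub>R f}"
    {
      assume g: "g \<in> {f \<in> functions_on B. steklov_operator E B w f = \<mu> *\<^sub>R f}"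
      show "f + g \<in> {f \<in> functions_on B. steklov_operator E B w f = \<mu> *\<^sub>R f}"
        using f g steklov_operator_lincomb[of f g 1 1] subspace_add[OF subspace_functions_on, of f B g]
        by (auto simp: algebra_simps)
    }
    fix c
    show "c *\<^sub>R f \<in> {f \<in> functions_on B. steklov_operator E B w f = \<mu> *\<^sub>R f}"
      using f steklov_operator_lincomb[of f f c 0] subspace_scale[OF subspace_functions_on, of f B c]
      by (auto simp: algebra_simps)
  qed
qed

text \<open>Both sides equal the energy pairing of the harmonic extensions: on \<open>B\<close> the
  extension of \<open>f\<close> is \<open>f\<close>, and off \<open>B\<close> the Laplacian of the
  other extension vanishes.\<close>

lemma steklov_operator_symmetric:
  assumes f: "f \<in> functions_on B" and g: "g \<in> functions_on B"
  shows "f \<bullet> steklov_operator E B w g = steklov_operator E B w f \<bullet> g"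
proof -
  have energy: "f \<bullet> steklov_operator E B w g =
      harmonic_extension E B w f \<bullet> laplacian UNIV w (harmonic_extension E B w g)"
    if f: "f \<in> functions_on B" and g: "g \<in> functions_on B" for f g
    unfolding inner_vec_def
    by (rule sum.cong) (use f scaled_extension(2)[OF f] scaled_extension(3)[OF g] in
        \<open>auto simp: steklov_operator_nth\<close>)
  show ?thesis
    by (subst inner_commute[of _ g], subst energy[OF f g], subst energy[OF g f])
       (simp add: inner_laplacian_UNIV algebra_simps)
qed

end

subsection \<open>Krylov vectors\<close>

text \<open>Iterating the scaled operator keeps the entries polynomial in \<open>w\<close>. For
  \<open>x \<in> B\<close> and nonzero determinant these are the powers of \<Lambda> applied to
  \<open>axis x 1\<close>, up to nonzero factors.\<close>

definition krylov :: "'v::finite set \<Rightarrow> 'v \<Rightarrow> real^'v set \<Rightarrow> nat \<Rightarrow> real^'v" where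
  "krylov B x w j = (scaled_steklov B w ^^ j) (axis x 1)"

text \<open>The identity off \<open>B\<close> leaves only functions on \<open>B\<close> in the kernel.\<close>

definition krylov_gram :: "'v::finite set \<Rightarrow> 'v \<Rightarrow> nat \<Rightarrow> real^'v set \<Rightarrow> real^'v^'v" where
  "krylov_gram B x n w =
     (\<chi> i k. (if i = k \<and> i \<notin> B then 1 else 0) + (\<Sum>j\<le>n. krylov B x w j $ i * krylov B x w j $ k))"

lemma krylov_gram_mult:
  "(krylov_gram B x n w *v f) $ i =
     (if i \<notin> B then f $ i else 0) + (\<Sum>j\<le>n. krylov B x w j $ i * (krylov B x w j \<bullet> f))"
proof -
  have "(krylov_gram B x n w *v f) $ i = (\<Sum>k\<in>UNIV. (if i = k then (if i \<notin> B then f $ k else 0) else 0)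
      + (\<Sum>j\<le>n. krylov B x w j $ i * (krylov B x w j $ k * f $ k)))"
    unfolding matrix_vector_mult_def krylov_gram_def
    by (auto intro!: sum.cong simp: sum_distrib_right distrib_right mult.assoc)
  also have "\<dots> = (if i \<notin> B then f $ i else 0)
      + (\<Sum>k\<in>UNIV. \<Sum>j\<le>n. krylov B x w j $ i * (krylov B x w j $ k * f $ k))"
    by (simp add: sum.distrib sum.delta')
  also have "(\<Sum>k\<in>UNIV. \<Sum>j\<le>n. krylov B x w j $ i * (krylov B x w j $ k * f $ k)) =
      (\<Sum>j\<le>n. krylov B x w j $ i * (krylov B x w j \<bullet> f))"
    by (subst sum.swap) (simp add: inner_vec_def sum_distrib_left)
  finally show ?thesis .
qed

lemma matrix_det_0_iff_kernel:
  fixes M :: "real^'n^'n"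
  shows "det M = 0 \<longleftrightarrow> (\<exists>f. f \<noteq> 0 \<and> M *v f = 0)"
  using invertible_det_nz[of M] matrix_left_invertible_ker[of M] invertible_left_inverse[of M] by blast

text \<open>Pairing the image of \<open>f\<close> with \<open>f\<close> gives the squares of the
  entries off \<open>B\<close> plus the squares of the inner products, so the kernel is their common
  zero set.\<close>

lemma det_krylov_gram_eq_0_iff:
  "det (krylov_gram B x n w) = 0 \<longleftrightarrow>
    (\<exists>f\<in>functions_on B. f \<noteq> 0 \<and> (\<forall>j\<le>n. krylov B x w j \<bullet> f = 0))"
proof -
  have "krylov_gram B x n w *v f = 0 \<longleftrightarrow> f \<in> functions_on B \<and> (\<forall>j\<le>n. krylov B x w j \<bullet> f = 0)" for f
  proof
    assume f: "krylov_gram B x n w *v f = 0"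
    have "0 = f \<bullet> (krylov_gram B x n w *v f)"
      using f by simp
    also have "\<dots> = (\<Sum>i\<in>UNIV. if i \<notin> B then f $ i * f $ i else 0)
        + (\<Sum>i\<in>UNIV. \<Sum>j\<le>n. krylov B x w j $ i * f $ i * (krylov B x w j \<bullet> f))"
      unfolding inner_vec_def[of f] krylov_gram_mult sum.distrib[symmetric]
      by (rule sum.cong) (auto simp: algebra_simps sum_distrib_left)
    also have "\<dots> = (\<Sum>i\<in>UNIV. if i \<notin> B then f $ i * f $ i else 0)
        + (\<Sum>j\<le>n. (krylov B x w j \<bullet> f) * (krylov B x w j \<bullet> f))"
      by (subst sum.swap) (simp add: inner_vec_def sum_distrib_right)
    finally have sum: "(\<Sum>i\<in>UNIV. if i \<notin> B then f $ i * f $ i else 0)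
        + (\<Sum>j\<le>n. (krylov B x w j \<bullet> f) * (krylov B x w j \<bullet> f)) = 0" by simp
    have nonneg: "(\<Sum>i\<in>UNIV. if i \<notin> B then f $ i * f $ i else 0) \<ge> 0"
      "(\<Sum>j\<le>n. (krylov B x w j \<bullet> f) * (krylov B x w j \<bullet> f)) \<ge> 0"
      by (auto intro!: sum_nonneg)
    have "(\<Sum>i\<in>UNIV. if i \<notin> B then f $ i * f $ i else 0) = 0"
      and "(\<Sum>j\<le>n. (krylov B x w j \<bullet> f) * (krylov B x w j \<bullet> f)) = 0"
      using sum nonneg by linarith+
    then show "f \<in> functions_on B \<and> (\<forall>j\<le>n. krylov B x w j \<bullet> f = 0)"
      by (subst (asm) (1 2) sum_nonneg_eq_0_iff) (auto simp: functions_on_def split: if_splits)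
  next
    assume "f \<in> functions_on B \<and> (\<forall>j\<le>n. krylov B x w j \<bullet> f = 0)"
    then show "krylov_gram B x n w *v f = 0"
      unfolding vec_eq_iff krylov_gram_mult by (auto simp: functions_on_def)
  qed
  then show ?thesis unfolding matrix_det_0_iff_kernel by blast
qed

lemma krylov_in: "x \<in> B \<Longrightarrow> krylov B x w j \<in> functions_on B"
proof (cases j)
  case 0
  then show "x \<in> B \<Longrightarrow> krylov B x w j \<in> functions_on B"
    by (auto simp: krylov_def functions_on_def axis_def)
qed (simp add: krylov_def scaled_steklov_in)

lemma krylov_Suc: "krylov B x w (Suc j) = scaled_steklov B w (krylov B x w j)"
  by (simp add: krylov_def)

section \<open>Polynomial dependence on the weight\<close>

lemma real_polynomial_function_det:
  fixes M :: "'a::real_normed_vector \<Rightarrow> real^'n^'n"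
  assumes "\<And>i j. real_polynomial_function (\<lambda>w. M w $ i $ j)"
  shows "real_polynomial_function (\<lambda>w. det (M w))"
  unfolding det_def
  by (intro real_polynomial_function_sum real_polynomial_function.intros(4) real_polynomial_function_prod
      real_polynomial_function.intros(2) assms) auto

lemma real_polynomial_function_nth: "real_polynomial_function (\<lambda>w. w $ i)"
  by (intro real_polynomial_function.intros(1) bounded_linear_vec_nth)

lemma real_polynomial_function_laplacian:
  assumes "\<And>v. real_polynomial_function (\<lambda>w. u w $ v)"
  shows "real_polynomial_function (\<lambda>w. laplacian UNIV w (u w) $ v)"
  unfolding laplacian_UNIV_nth
  by (intro real_polynomial_function_sum real_polynomial_function.intros(4) real_polynomial_function_diff
      real_polynomial_function_nth assms) auto

text \<open>Each step takes determinants with polynomial entries and then a Laplacian; there is no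
  division.\<close>

lemma real_polynomial_function_krylov: "real_polynomial_function (\<lambda>w. krylov B x w j $ i)"
proof (induction j arbitrary: i)
  case 0
  show ?case by (simp add: krylov_def real_polynomial_function.intros(2))
next
  case (Suc j)
  have M: "real_polynomial_function (\<lambda>w. dirichlet_matrix B w $ i $ k)" for i k
    unfolding dirichlet_matrix_def matrix_def
    by (cases "i \<in> B") (simp_all add: real_polynomial_function.intros(2) real_polynomial_function_laplacian)
  have "real_polynomial_function (\<lambda>w. scaled_extension B w (krylov B x w j) $ k)" for k
    unfolding scaled_extension_def vec_lambda_beta
  proof (rule real_polynomial_function_det)
    show "real_polynomial_function (\<lambda>w. (\<chi> i l. if l = k then krylov B x w j $ i
        else dirichlet_matrix B w $ i $ l) $ i $ l)" for i l
      by (cases "l = k") (simp_all add: M Suc.IH)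
  qed
  then show ?case
    unfolding krylov_Suc scaled_steklov_def
    by (cases "i \<in> B") (simp_all add: real_polynomial_function.intros(2) real_polynomial_function_laplacian)
qed

lemma real_polynomial_function_krylov_gram:
  "real_polynomial_function (\<lambda>w. det (krylov_gram B x n w))"
  unfolding krylov_gram_def
  by (rule real_polynomial_function_det, unfold vec_lambda_beta)
     (intro real_polynomial_function.intros(2-4) real_polynomial_function_sum real_polynomial_function_krylov; simp)

text \<open>Symmetry moves the operator onto \<open>f\<close>, where it acts as a scalar, so every
  inner product is a multiple of \<open>f $ x = 0\<close>.\<close>

lemma krylov_gram_singular:
  fixes E :: "'v::finite set set"
  assumes w: "w \<in> functions_on E" and det: "det (dirichlet_matrix B w) \<noteq> 0" and x: "x \<in> B"
    and f: "steklov_eigenfunction E B w f" "f $ x = 0"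
  shows "det (krylov_gram B x n w) = 0"
proof -
  obtain \<mu> where fB: "f \<in> functions_on B" and f0: "f \<noteq> 0" and eig: "steklov_operator E B w f = \<mu> *\<^sub>R f"
    using f(1) by (auto simp: steklov_eigenfunction_def steklov_eigenspace_def)
  have "krylov B x w j \<bullet> f = 0" for j
  proof (induction j)
    case 0
    show ?case using f(2) by (simp add: krylov_def inner_axis')
  next
    case (Suc j)
    have "steklov_operator E B w (krylov B x w j) \<bullet> f = krylov B x w j \<bullet> steklov_operator E B w f"
      using steklov_operator_symmetric[OF w det krylov_in[OF x] fB] by simp
    then show ?case
      using Suc.IH by (simp add: krylov_Suc scaled_steklov_eq[OF w det krylov_in[OF x]] eig)
  qed
  then show ?thesis using fB f0 by (auto simp: det_krylov_gram_eq_0_iff)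
qed

text \<open>Once the dimension is minimal, later subspaces are contained in the current one and have
  equal dimension.\<close>

lemma decreasing_subspaces_stabilize:
  fixes K :: "nat \<Rightarrow> 'a::euclidean_space set"
  assumes sub: "\<And>n. subspace (K n)" and dec: "\<And>m n. m \<le> n \<Longrightarrow> K n \<subseteq> K m"
  obtains N where "\<And>n. K N \<subseteq> K n"
proof -
  obtain N where N: "\<And>n. dim (K N) \<le> dim (K n)"
    using ex_has_least_nat[of "\<lambda>_. True" 0 "\<lambda>n. dim (K n)"] by auto
  have "K N \<subseteq> K n" for n
  proof (cases "n \<le> N")
    case False
    then have "K n = K N"
      using dec[of N n] N[of n] by (intro subspace_dim_equal sub) auto
    then show ?thesis by simp
  qed (use dec in auto)
  then show ?thesis using that by blast
qed

text \<open>At an observable weight, if the Gram matrices stayed singular, the vectors orthogonal to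
  all Krylov vectors would form a nonzero invariant subspace, containing an eigenfunction that
  vanishes at \<open>x\<close>.\<close>

lemma exists_nonsingular_krylov_gram:
  fixes E :: "'v::finite set set"
  assumes conn: "connected_graph E" and x: "x \<in> B"
  obtains n w where "w \<in> functions_on E" "det (krylov_gram B x n w) \<noteq> 0"
proof -
  obtain w where obs: "observable_from E B x UNIV w"
    using observable_weights_exist[OF conn] .
  have w: "w \<in> functions_on E"
    using observable_fromD(2)[OF obs] by (auto simp: functions_on_def)
  have det: "det (dirichlet_matrix B w) \<noteq> 0"
  proof (rule det_dirichlet_matrix_nonzero)
    show "0 \<le> w $ e" for e by (rule observable_fromD(1)[OF obs])
    show "h = 0" if "laplacian UNIV w h = 0" "\<forall>v\<in>B. h $ v = 0" for h
      using observable_from_harmonic[OF obs _ that(1)] that(2) x by (simp add: vec_eq_iff)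
  qed
  define K where "K n = {f \<in> functions_on B. \<forall>j\<le>n. krylov B x w j \<bullet> f = 0}" for n
  have sub: "subspace (K n)" for n
    using subspace_functions_on[of B] unfolding K_def subspace_def by (auto simp: inner_add_right)
  have dec: "K n \<subseteq> K m" if "m \<le> n" for m n
    using that by (auto simp: K_def)
  \<comment> \<open>Beyond \<open>n\<close> no condition is new, so \<open>K n\<close> is orthogonal
    to all Krylov vectors; this is what makes it invariant.\<close>
  obtain n where n: "\<And>m. K n \<subseteq> K m"
    using decreasing_subspaces_stabilize[of K, OF sub dec] by blast
  have orth: "krylov B x w j \<bullet> f = 0" if "f \<in> K n" for f j
    using n[of j] that by (auto simp: K_def)
  have "det (krylov_gram B x n w) \<noteq> 0"
  proof
    assume "det (krylov_gram B x n w) = 0"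
    then obtain k where k: "k \<in> K n" "k \<noteq> 0"
      unfolding det_krylov_gram_eq_0_iff K_def by blast
    have KB: "f \<in> functions_on B" if "f \<in> K n" for f using that by (simp add: K_def)
    \<comment> \<open>Linearity of the Steklov operator is known on functions on \<open>B\<close>;
      composing with the projection \<open>P\<close> gives a linear map on the whole space.\<close>
    define P where "P f = (\<chi> v. if v \<in> B then f $ v else 0)" for f :: "real^'v"
    have PB: "P f \<in> functions_on B" for f by (simp add: P_def functions_on_def)
    have P: "P f = f" if "f \<in> functions_on B" for f
      using that by (auto simp: P_def functions_on_def vec_eq_iff)
    define T where "T f = steklov_operator E B w (P f)" for f
    have "linear P"
      unfolding P_def by (rule linearI) (auto simp: vec_eq_iff)
    then have "linear T"
      using steklov_operator_lincomb[OF w det PB PB, of 1 _ 1] steklov_operator_lincomb[OF w det PB PB, of _ _ 0]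
      by (intro linearI) (simp_all add: T_def linear_add linear_scale)
    moreover have "T u \<in> K n" if u: "u \<in> K n" for u
    proof -
      have "krylov B x w j \<bullet> steklov_operator E B w u = 0" for j
      proof -
        \<comment> \<open>By symmetry, applying the operator to \<open>u\<close> raises the Krylov
          index by one, up to the nonzero determinant.\<close>
        have "0 = krylov B x w (Suc j) \<bullet> u" using orth[OF u] by simp
        also have "\<dots> = det (dirichlet_matrix B w) * (steklov_operator E B w (krylov B x w j) \<bullet> u)"
          by (simp add: krylov_Suc scaled_steklov_eq[OF w det krylov_in[OF x]])
        also have "\<dots> = det (dirichlet_matrix B w) * (krylov B x w j \<bullet> steklov_operator E B w u)"
          by (simp add: steklov_operator_symmetric[OF w det krylov_in[OF x] KB[OF u]])
        finally show ?thesis using det by simp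
      qed
      then show ?thesis
        by (simp add: K_def T_def P KB[OF u] steklov_operator_in[OF w det])
    qed
    moreover have "u \<bullet> T v = T u \<bullet> v" if "u \<in> K n" "v \<in> K n" for u v
      using steklov_operator_symmetric[OF w det KB KB] that by (simp add: T_def P KB)
    ultimately obtain g \<mu> where g: "g \<in> K n" "g \<noteq> 0" "T g = \<mu> *\<^sub>R g"
      by (rule symmetric_invariant_subspace_eigenvector[OF _ sub _ _ k]) auto
    have gB: "g \<in> functions_on B" using g(1) by (rule KB)
    have gx: "g $ x = 0" using orth[OF g(1), of 0] by (simp add: krylov_def inner_axis')
    let ?h = "harmonic_extension E B w g"
    note h = scaled_extension(2,3)[OF w det gB]
    have "laplacian UNIV w ?h $ v = (if v \<in> B then \<mu> * ?h $ v else 0)" for v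
    proof (cases "v \<in> B")
      case True
      have "steklov_operator E B w g $ v = (\<mu> *\<^sub>R g) $ v" using g(3) by (simp add: T_def P[OF gB])
      then show ?thesis using True h(1)[of v] by (simp add: steklov_operator_nth[OF w det])
    qed (simp add: h)
    then have "?h $ v = 0" for v
      using observable_fromD(4)[OF obs, of ?h \<mu> v] h(1)[OF x] gx by simp
    then have "g = 0" using h(1) gB by (auto simp: vec_eq_iff functions_on_def)
    then show False using g(2) by simp
  qed
  then show ?thesis using that w by blast
qed

text \<open>Otherwise evaluation at \<open>x\<close> is injective on \<open>S\<close>, and all
  elements are multiples of one.\<close>

lemma eigenspace_vanishing_element:
  fixes S :: "(real^'v::finite) set"
  assumes S: "subspace S" and dim: "dim S > 1"
  shows "\<exists>f\<in>S. f \<noteq> 0 \<and> f $ x = 0"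
proof (rule ccontr)
  assume "\<not> ?thesis"
  then have inj: "f = 0" if "f \<in> S" "f $ x = 0" for f using that by blast
  have "\<not> S \<subseteq> {0}"
    using dim by (simp flip: dim_eq_0)
  then obtain b where b: "b \<in> S" "b \<noteq> 0" by blast
  have bx: "b $ x \<noteq> 0" using b inj by blast
  have "S \<subseteq> span {b}"
  proof
    fix f assume f: "f \<in> S"
    have "f - (f $ x / b $ x) *\<^sub>R b = 0"
      using f b bx S by (intro inj) (auto simp: subspace_diff subspace_scale)
    then show "f \<in> span {b}" by (simp add: span_singleton)
  qed
  then have "dim S \<le> card {b}" using b by (intro span_card_ge_dim) auto
  then show False using dim by simp
qed

subsection \<open>Polynomial functions\<close>

text \<open>An upper bound on the degree is carried along for inductions over partial derivatives.\<close>

inductive poly_deg :: "'i set \<Rightarrow> nat \<Rightarrow> (real^'i::finite \<Rightarrow> real) \<Rightarrow> bool" for E where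
  const: "poly_deg E n (\<lambda>_. c)"
| coord: "poly_deg E n f \<Longrightarrow> i \<in> E \<Longrightarrow> poly_deg E (Suc n) (\<lambda>x. x $ i * f x)"
| add: "poly_deg E n f \<Longrightarrow> poly_deg E n g \<Longrightarrow> poly_deg E n (\<lambda>x. f x + g x)"

lemma poly_deg_mono: "poly_deg E n f \<Longrightarrow> n \<le> m \<Longrightarrow> poly_deg E m f"
proof (induction arbitrary: m rule: poly_deg.induct)
  case (coord n f i)
  then show ?case by (cases m) (auto intro: poly_deg.coord)
qed (auto intro: poly_deg.const poly_deg.add)

lemma poly_deg_scale: "poly_deg E n f \<Longrightarrow> poly_deg E n (\<lambda>x. c * f x)"
proof (induction rule: poly_deg.induct)
  case (coord n f i)
  then show ?case using poly_deg.coord[of E n "\<lambda>x. c * f x" i] by (simp add: algebra_simps)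
next
  case (add n f g)
  then show ?case using poly_deg.add by (auto simp: distrib_left)
qed (auto intro: poly_deg.const)

lemma poly_deg_mult: "poly_deg E n f \<Longrightarrow> poly_deg E m g \<Longrightarrow> poly_deg E (n + m) (\<lambda>x. f x * g x)"
proof (induction rule: poly_deg.induct)
  case (const n c)
  then show ?case using poly_deg_scale poly_deg_mono by (metis le_add2)
next
  case (coord n f i)
  then show ?case using poly_deg.coord[of E "n + m" "\<lambda>x. f x * g x" i] by (simp add: algebra_simps)
next
  case (add n f h)
  then show ?case using poly_deg.add by (auto simp: distrib_right)
qed

lemma poly_deg_sum:
  "finite A \<Longrightarrow> (\<And>a. a \<in> A \<Longrightarrow> poly_deg E n (f a)) \<Longrightarrow> poly_deg E n (\<lambda>x. \<Sum>a\<in>A. f a x)"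
  by (induction rule: finite_induct) (auto intro: poly_deg.const poly_deg.add)

lemma poly_deg_0: "poly_deg E n f \<Longrightarrow> n = 0 \<Longrightarrow> \<exists>c. f = (\<lambda>_. c)"
  by (induction rule: poly_deg.induct) auto

text \<open>A linear form is expanded in coordinates, and those outside \<open>E\<close> vanish on
  \<open>functions_on E\<close>. For sums, \<open>n + m\<close> is a crude common degree
  bound.\<close>

lemma real_polynomial_function_imp_poly_deg:
  fixes F :: "real^'i::finite \<Rightarrow> real"
  assumes "real_polynomial_function F"
  shows "\<exists>n g. poly_deg E n g \<and> (\<forall>x\<in>functions_on E. F x = g x)"
  using assms
proof (induction rule: real_polynomial_function.induct)
  case (linear f)
  have "poly_deg E 1 (\<lambda>x. \<Sum>i\<in>E. x $ i * f (axis i 1))"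
    using poly_deg.coord[OF poly_deg.const, of _ E 0] by (intro poly_deg_sum) auto
  moreover have "f x = (\<Sum>i\<in>E. x $ i * f (axis i 1))" if "x \<in> functions_on E" for x
  proof -
    have lin: "linear f" using linear by (simp add: bounded_linear.linear)
    have "f x = f (\<Sum>i\<in>UNIV. x $ i *\<^sub>R axis i 1)"
      using basis_expansion[of x] by (simp add: scalar_mult_eq_scaleR)
    also have "\<dots> = (\<Sum>i\<in>UNIV. x $ i * f (axis i 1))"
      by (simp add: linear_sum[OF lin] linear_scale[OF lin])
    also have "\<dots> = (\<Sum>i\<in>E. x $ i * f (axis i 1))"
      using that by (intro sum.mono_neutral_right) (auto simp: functions_on_def)
    finally show ?thesis .
  qed
  ultimately show ?case by blast
next
  case (const c)
  then show ?case using poly_deg.const by blast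
next
  case (add f g)
  then obtain n f' m g' where "poly_deg E n f'" "\<forall>x\<in>functions_on E. f x = f' x"
      "poly_deg E m g'" "\<forall>x\<in>functions_on E. g x = g' x" by blast
  moreover from this have "poly_deg E (n + m) (\<lambda>x. f' x + g' x)" (is "poly_deg E _ ?h")
    by (intro poly_deg.add) (auto elim: poly_deg_mono)
  ultimately show ?case by (intro exI[of _ "n + m"] exI[of _ ?h]) auto
next
  case (mult f g)
  then obtain n f' m g' where "poly_deg E n f'" "\<forall>x\<in>functions_on E. f x = f' x"
      "poly_deg E m g'" "\<forall>x\<in>functions_on E. g x = g' x" by blast
  moreover from this have "poly_deg E (n + m) (\<lambda>x. f' x * g' x)" (is "poly_deg E _ ?h")
    by (intro poly_deg_mult)
  ultimately show ?case by (intro exI[of _ "n + m"] exI[of _ ?h]) auto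
qed

section \<open>Finitely supported polynomials\<close>

lemma mpoly_eval_superset:
  assumes "finite K" "Poly_Mapping.keys p \<subseteq> K"
  shows "mpoly_eval p x = (\<Sum>m\<in>K. Poly_Mapping.lookup p m * (\<Prod>i\<in>UNIV. (x $ i) ^ Poly_Mapping.lookup m i))"
proof -
  have "(\<Prod>i\<in>Poly_Mapping.keys m. (x $ i) ^ Poly_Mapping.lookup m i) =
      (\<Prod>i\<in>UNIV. (x $ i) ^ Poly_Mapping.lookup m i)" for m :: "'a \<Rightarrow>\<^sub>0 nat"
    by (rule prod.mono_neutral_left) (auto simp: in_keys_iff)
  then show ?thesis
    unfolding mpoly_eval_def using assms
    by (intro sum.mono_neutral_cong_left) (auto simp: in_keys_iff)
qed

text \<open>Keys can cancel in a sum, so all three evaluations run over the union of the keys of the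
  summands.\<close>

lemma mpoly_eval_add: "mpoly_eval (p + q) x = mpoly_eval p x + mpoly_eval q x"
proof -
  let ?K = "Poly_Mapping.keys p \<union> Poly_Mapping.keys q"
  note e = mpoly_eval_superset[of ?K]
  show ?thesis
    using e[of p x] e[of q x] e[of "p + q" x] keys_add[of p q]
    by (simp add: lookup_add sum.distrib distrib_right)
qed

lemma mpoly_eval_single:
  "mpoly_eval (Poly_Mapping.single m c) x = c * (\<Prod>i\<in>UNIV. (x $ i) ^ Poly_Mapping.lookup m i)"
  by (subst mpoly_eval_superset[of "{m}"]) auto

lemma mpoly_eval_sum: "mpoly_eval (\<Sum>a\<in>A. p a) x = (\<Sum>a\<in>A. mpoly_eval (p a) x)"
  by (induction A rule: infinite_finite_induct) (simp_all add: mpoly_eval_add, simp_all add: mpoly_eval_def)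

lemma mpoly_vars_add: "mpoly_vars (p + q) \<subseteq> mpoly_vars p \<union> mpoly_vars q"
  using keys_add[of p q] by (auto simp: mpoly_vars_def)

lemma mpoly_vars_sum: "mpoly_vars (\<Sum>a\<in>A. p a) \<subseteq> (\<Union>a\<in>A. mpoly_vars (p a))"
proof (induction A rule: infinite_finite_induct)
  case (insert a A)
  then show ?case using mpoly_vars_add[of "p a" "sum p A"] by auto
qed (auto simp: mpoly_vars_def)

lemma mpoly_times_coord:
  fixes p :: "'i::finite real_mpoly"
  obtains q where "mpoly_vars q \<subseteq> insert i (mpoly_vars p)" "\<And>x. mpoly_eval q x = x $ i * mpoly_eval p x"
proof
  define q where "q = (\<Sum>m\<in>Poly_Mapping.keys p.
    Poly_Mapping.single (m + Poly_Mapping.single i 1) (Poly_Mapping.lookup p m))"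
  show "mpoly_vars q \<subseteq> insert i (mpoly_vars p)"
  proof -
    have "mpoly_vars (Poly_Mapping.single (m + Poly_Mapping.single i 1) (Poly_Mapping.lookup p m))
        \<subseteq> insert i (mpoly_vars p)" if "m \<in> Poly_Mapping.keys p" for m
      using that keys_add[of m "Poly_Mapping.single i 1"] by (auto simp: mpoly_vars_def)
    then show ?thesis unfolding q_def by (intro order_trans[OF mpoly_vars_sum] UN_least)
  qed
  fix x :: "real^'i"
  have "(\<Prod>j\<in>UNIV. (x $ j) ^ Poly_Mapping.lookup (m + Poly_Mapping.single i 1) j) =
      x $ i * (\<Prod>j\<in>UNIV. (x $ j) ^ Poly_Mapping.lookup m j)" for m
  proof -
    have "(\<Prod>j\<in>UNIV. (x $ j) ^ Poly_Mapping.lookup (m + Poly_Mapping.single i 1) j) =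
      (\<Prod>j\<in>UNIV. (if j = i then x $ j else 1) * (x $ j) ^ Poly_Mapping.lookup m j)"
      by (rule prod.cong) (auto simp: lookup_add lookup_single)
    then show ?thesis by (simp add: prod.distrib prod.delta)
  qed
  then show "mpoly_eval q x = x $ i * mpoly_eval p x"
    unfolding q_def mpoly_eval_sum mpoly_eval_single
    by (subst mpoly_eval_superset[of "Poly_Mapping.keys p"]) (auto simp: sum_distrib_left algebra_simps)
qed

lemma poly_deg_imp_mpoly:
  assumes "poly_deg E n f"
  shows "\<exists>p. mpoly_vars p \<subseteq> E \<and> (\<forall>x. mpoly_eval p x = f x)"
  using assms
proof (induction rule: poly_deg.induct)
  case (const n c)
  show ?case
    by (rule exI[of _ "Poly_Mapping.single 0 c"]) (auto simp: mpoly_vars_def mpoly_eval_single)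
next
  case (coord n f i)
  then obtain p where p: "mpoly_vars p \<subseteq> E" "\<forall>x. mpoly_eval p x = f x" by blast
  obtain q where "mpoly_vars q \<subseteq> insert i (mpoly_vars p)" "\<And>x. mpoly_eval q x = x $ i * mpoly_eval p x"
    by (rule mpoly_times_coord[of i p]) blast
  then show ?case using p coord.hyps by (intro exI[of _ q]) auto
next
  case (add n f g)
  then obtain p q where "mpoly_vars p \<subseteq> E" "\<forall>x. mpoly_eval p x = f x"
    "mpoly_vars q \<subseteq> E" "\<forall>x. mpoly_eval q x = g x" by blast
  then show ?case
    using mpoly_vars_add[of p q] by (intro exI[of _ "p + q"]) (auto simp: mpoly_eval_add)
qed

text \<open>On the line through \<open>a\<close> and \<open>b\<close>, \<open>F\<close> is nonzero
  at parameter 0 and \<open>G\<close> at parameter 1, so both are nonzero polynomials in one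
  variable with finitely many zeros.\<close>

lemma real_polynomial_function_mult_nonzero:
  fixes F G :: "'a::real_normed_vector \<Rightarrow> real"
  assumes F: "real_polynomial_function F" and G: "real_polynomial_function G" and S: "subspace S"
    and a: "a \<in> S" "F a \<noteq> 0" and b: "b \<in> S" "G b \<noteq> 0"
  obtains c where "c \<in> S" "F c * G c \<noteq> 0"
proof -
  define l where "l t = a + t *\<^sub>R (b - a)" for t :: real
  have line: "polynomial_function l"
    unfolding l_def
    by (intro polynomial_function_add polynomial_function_mult polynomial_function_const polynomial_function_id)
  have finite_zeros: "finite {t. H (l t) = 0}" if H: "real_polynomial_function H" "H (l s) \<noteq> 0"
    for H :: "'a \<Rightarrow> real" and s
  proof -
    obtain c n where c: "H \<circ> l = (\<lambda>t. \<Sum>i\<le>n. c i * t ^ i)"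
      using real_polynomial_function_compose[OF line H(1)] real_polynomial_function_iff_sum by metis
    have "\<exists>i\<le>n. c i \<noteq> 0"
    proof (rule ccontr)
      assume "\<not> ?thesis"
      then show False using fun_cong[OF c, of s] H(2) by (simp add: sum.neutral)
    qed
    then have "finite {t. (\<Sum>i\<le>n. c i * t ^ i) = 0}"
      by (simp add: Transcendental.polyfun_finite_roots)
    then show ?thesis using fun_cong[OF c] by simp
  qed
  have "finite ({t. F (l t) = 0} \<union> {t. G (l t) = 0})"
    using finite_zeros[OF F, of 0] finite_zeros[OF G, of 1] a b by (simp add: l_def)
  then obtain t where "t \<notin> {t. F (l t) = 0} \<union> {t. G (l t) = 0}"
    using ex_new_if_finite[OF infinite_UNIV_char_0] by metis
  moreover have "l t \<in> S" using a b S by (simp add: l_def subspace_add subspace_diff subspace_scale)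
  ultimately show ?thesis using that by auto
qed

lemma real_polynomial_function_prod_nonzero:
  fixes F :: "'b \<Rightarrow> 'a::real_normed_vector \<Rightarrow> real"
  assumes "finite A" and S: "subspace S"
    and F: "\<And>a. a \<in> A \<Longrightarrow> real_polynomial_function (F a)" "\<And>a. a \<in> A \<Longrightarrow> \<exists>x\<in>S. F a x \<noteq> 0"
  shows "\<exists>x\<in>S. (\<Prod>a\<in>A. F a x) \<noteq> 0"
  using assms(1) F
proof (induction rule: finite_induct)
  case empty
  then show ?case using subspace_0[OF S] by auto
next
  case (insert a A)
  obtain x y where "x \<in> S" "F a x \<noteq> 0" "y \<in> S" "(\<Prod>a\<in>A. F a y) \<noteq> 0"
    using insert by blast
  moreover have "real_polynomial_function (\<lambda>x. \<Prod>a\<in>A. F a x)"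
    using insert by (intro real_polynomial_function_prod) auto
  ultimately obtain z where "z \<in> S" "F a z * (\<Prod>a\<in>A. F a z) \<noteq> 0"
    using real_polynomial_function_mult_nonzero[OF _ _ S] insert.prems(1) by (metis insertI1)
  then show ?case using insert.hyps by (intro bexI[of _ z]) simp_all
qed

subsection \<open>Hausdorff measure of polynomial zero sets\<close>

lemma hausdorff_measure_eq_0_iff:
  "hausdorff_measure s A = 0 \<longleftrightarrow>
    (\<forall>\<delta>>0. \<forall>\<epsilon>>0. \<exists>U :: nat \<Rightarrow> 'a::metric_space set. A \<subseteq> (\<Union>i. U i) \<and>
      (\<forall>i. bounded (U i) \<and> diameter (U i) \<le> \<delta>) \<and> suminf (\<lambda>i. hausdorff_gauge s (U i)) \<le> ennreal \<epsilon>)"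
    (is "_ \<longleftrightarrow> ?rhs")
proof
  assume null: "hausdorff_measure s A = 0"
  show ?rhs
  proof (intro allI impI)
    fix \<delta> \<epsilon> :: real assume "\<delta> > 0" "\<epsilon> > 0"
    have "hausdorff_premeasure s \<delta> A \<le> hausdorff_measure s A"
      unfolding hausdorff_measure_def using \<open>\<delta> > 0\<close> by (intro SUP_upper) simp
    then have "hausdorff_premeasure s \<delta> A = 0" using null by simp
    then have "hausdorff_premeasure s \<delta> A < ennreal \<epsilon>" using \<open>\<epsilon> > 0\<close> by simp
    then show "\<exists>U :: nat \<Rightarrow> 'a set. A \<subseteq> (\<Union>i. U i) \<and>
      (\<forall>i. bounded (U i) \<and> diameter (U i) \<le> \<delta>) \<and> suminf (\<lambda>i. hausdorff_gauge s (U i)) \<le> ennreal \<epsilon>"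
      unfolding hausdorff_premeasure_def INF_less_iff by (blast intro: less_imp_le)
  qed
next
  assume R: ?rhs
  have "hausdorff_premeasure s \<delta> A \<le> 0" if "\<delta> > 0" for \<delta>
  proof (rule ennreal_le_epsilon)
    fix \<epsilon> :: real assume "\<epsilon> > 0"
    then obtain U :: "nat \<Rightarrow> 'a set" where U: "A \<subseteq> (\<Union>i. U i)"
        "\<forall>i. bounded (U i) \<and> diameter (U i) \<le> \<delta>" "suminf (\<lambda>i. hausdorff_gauge s (U i)) \<le> ennreal \<epsilon>"
      using R \<open>\<delta> > 0\<close> by meson
    then have "hausdorff_premeasure s \<delta> A \<le> suminf (\<lambda>i. hausdorff_gauge s (U i))"
      unfolding hausdorff_premeasure_def by (intro INF_lower) auto
    then show "hausdorff_premeasure s \<delta> A \<le> 0 + ennreal \<epsilon>" using U(3) by simp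
  qed
  then show "hausdorff_measure s A = 0"
    unfolding hausdorff_measure_def by (intro antisym SUP_least) auto
qed

lemma hausdorff_null_mono:
  fixes A C :: "'a::metric_space set"
  assumes "hausdorff_measure s C = 0" "A \<subseteq> C"
  shows "hausdorff_measure s A = 0"
  unfolding hausdorff_measure_eq_0_iff
proof (intro allI impI)
  fix \<delta> \<epsilon> :: real assume "\<delta> > 0" "\<epsilon> > 0"
  then obtain U :: "nat \<Rightarrow> 'a set" where "C \<subseteq> (\<Union>i. U i)"
      "\<forall>i. bounded (U i) \<and> diameter (U i) \<le> \<delta>" "suminf (\<lambda>i. hausdorff_gauge s (U i)) \<le> ennreal \<epsilon>"
    using assms(1) unfolding hausdorff_measure_eq_0_iff by blast
  then show "\<exists>U :: nat \<Rightarrow> 'a set. A \<subseteq> (\<Union>i. U i) \<and>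
      (\<forall>i. bounded (U i) \<and> diameter (U i) \<le> \<delta>) \<and> suminf (\<lambda>i. hausdorff_gauge s (U i)) \<le> ennreal \<epsilon>"
    using assms(2) by (intro exI[of _ U]) auto
qed

text \<open>The \<open>n\<close>-th set gets the share \<open>\<epsilon> * (1/2) ^ Suc n\<close> of
  the cost, and the double sequence of covers is enumerated by the pairing function.\<close>

lemma hausdorff_null_UN:
  fixes A :: "nat \<Rightarrow> 'a::metric_space set"
  assumes "\<And>n. hausdorff_measure s (A n) = 0"
  shows "hausdorff_measure s (\<Union>n. A n) = 0"
  unfolding hausdorff_measure_eq_0_iff
proof (intro allI impI)
  fix \<delta> \<epsilon> :: real assume pos: "\<delta> > 0" "\<epsilon> > 0"
  have "\<exists>U :: nat \<Rightarrow> 'a set. A n \<subseteq> (\<Union>i. U i) \<and> (\<forall>i. bounded (U i) \<and> diameter (U i) \<le> \<delta>) \<and>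
      suminf (\<lambda>i. hausdorff_gauge s (U i)) \<le> ennreal (\<epsilon> * (1/2) ^ Suc n)" for n
  proof -
    have "\<epsilon> * (1/2) ^ Suc n > 0" using pos by simp
    then show ?thesis using assms[of n, unfolded hausdorff_measure_eq_0_iff] pos(1) by blast
  qed
  then obtain U :: "nat \<Rightarrow> nat \<Rightarrow> 'a set" where U: "\<And>n. A n \<subseteq> (\<Union>i. U n i)"
      "\<And>n i. bounded (U n i)" "\<And>n i. diameter (U n i) \<le> \<delta>"
      "\<And>n. suminf (\<lambda>i. hausdorff_gauge s (U n i)) \<le> ennreal (\<epsilon> * (1/2) ^ Suc n)"
    by metis
  define V where "V k = (case prod_decode k of (n, i) \<Rightarrow> U n i)" for k
  have "(\<Union>n. A n) \<subseteq> (\<Union>k. V k)"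
  proof
    fix x assume "x \<in> (\<Union>n. A n)"
    then obtain n i where "x \<in> U n i" using U(1) by blast
    then have "x \<in> V (prod_encode (n, i))" by (simp add: V_def)
    then show "x \<in> (\<Union>k. V k)" by blast
  qed
  moreover have "bounded (V k) \<and> diameter (V k) \<le> \<delta>" for k
    using U(2,3) by (simp add: V_def split: prod.split)
  moreover have "suminf (\<lambda>k. hausdorff_gauge s (V k)) \<le> ennreal \<epsilon>"
  proof -
    have "suminf (\<lambda>k. hausdorff_gauge s (V k)) = suminf (\<lambda>k. (\<lambda>(n, i). hausdorff_gauge s (U n i)) (prod_decode k))"
      unfolding V_def by (simp only: case_prod_unfold)
    also have "\<dots> = (suminf (\<lambda>n. suminf (\<lambda>i. hausdorff_gauge s (U n i))))"
      by (rule suminf_ennreal_2dimen) simp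
    also have "\<dots> \<le> suminf (\<lambda>n. ennreal (\<epsilon> * (1/2) ^ Suc n))"
      by (intro suminf_le U(4)) auto
    also have "\<dots> = ennreal \<epsilon>"
      using sums_mult[OF power_half_series, of \<epsilon>] pos
      by (intro suminf_ennreal_eq) auto
    finally show ?thesis .
  qed
  ultimately show "\<exists>U :: nat \<Rightarrow> 'a set. (\<Union>n. A n) \<subseteq> (\<Union>i. U i) \<and>
      (\<forall>i. bounded (U i) \<and> diameter (U i) \<le> \<delta>) \<and> suminf (\<lambda>i. hausdorff_gauge s (U i)) \<le> ennreal \<epsilon>"
    by blast
qed

lemma hausdorff_null_empty: "hausdorff_measure s {} = 0"
  unfolding hausdorff_measure_eq_0_iff
  by (intro allI impI exI[of _ "\<lambda>_. {}"]) (auto simp: hausdorff_gauge_def)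

lemma hausdorff_null_Un:
  assumes "hausdorff_measure s A = 0" "hausdorff_measure s C = 0"
  shows "hausdorff_measure s (A \<union> C) = 0"
proof -
  have "hausdorff_measure s (\<Union>n::nat. if n = 0 then A else C) = 0"
    by (rule hausdorff_null_UN) (use assms in auto)
  then show ?thesis by (rule hausdorff_null_mono) (auto split: if_splits)
qed

text \<open>By Lindelof, countably many open sets that meet \<open>A\<close> in null sets cover
  \<open>A\<close>.\<close>

lemma hausdorff_null_locally:
  fixes A :: "'a::euclidean_space set"
  assumes "\<And>z. z \<in> A \<Longrightarrow> \<exists>r>0. hausdorff_measure s (A \<inter> ball z r) = 0"
  shows "hausdorff_measure s A = 0"
proof -
  define F where "F = {U. open U \<and> hausdorff_measure s (A \<inter> U) = 0}"
  obtain F' where F': "F' \<subseteq> F" "countable F'" "\<Union>F' = \<Union>F"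
    using Lindelof[of F] by (auto simp: F_def)
  have sub: "A \<subseteq> \<Union>F'"
  proof
    fix z assume "z \<in> A"
    then obtain r where "r > 0" "ball z r \<in> F" using assms by (auto simp: F_def)
    then show "z \<in> \<Union>F'" unfolding F' by (auto intro!: bexI[of _ "ball z r"])
  qed
  show ?thesis
  proof (cases "F' = {}")
    case True
    then show ?thesis using sub hausdorff_null_empty by auto
  next
    case False
    have "hausdorff_measure s (\<Union>n. A \<inter> from_nat_into F' n) = 0"
      using F'(1) from_nat_into[OF False] by (intro hausdorff_null_UN) (auto simp: F_def)
    then show ?thesis
      by (rule hausdorff_null_mono)
         (use sub from_nat_into_surj[OF F'(2)] in \<open>fastforce\<close>)
  qed
qed

text \<open>With a common diameter bound \<eta> the cost is at most
  \<open>card I * \<eta> powr s\<close>. Padding with empty sets, whose gauge is 0, yields a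
  sequence.\<close>

lemma hausdorff_null_finite_covers:
  fixes A :: "'a::metric_space set"
  assumes s: "s > 0"
    and cover: "\<And>\<delta> \<epsilon>. \<delta> > 0 \<Longrightarrow> \<epsilon> > 0 \<Longrightarrow> \<exists>(I :: 'b set) U \<eta>. finite I \<and> A \<subseteq> (\<Union>i\<in>I. U i) \<and>
      (\<forall>i\<in>I. bounded (U i) \<and> diameter (U i) \<le> \<eta>) \<and> 0 \<le> \<eta> \<and> \<eta> \<le> \<delta> \<and> real (card I) * \<eta> powr s \<le> \<epsilon>"
  shows "hausdorff_measure s A = 0"
  unfolding hausdorff_measure_eq_0_iff
proof (intro allI impI)
  fix \<delta> \<epsilon> :: real assume pos: "\<delta> > 0" "\<epsilon> > 0"
  then obtain I :: "'b set" and U \<eta> where I: "finite I" "A \<subseteq> (\<Union>i\<in>I. U i)"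
      "\<And>i. i \<in> I \<Longrightarrow> bounded (U i)" "\<And>i. i \<in> I \<Longrightarrow> diameter (U i) \<le> \<eta>"
      "0 \<le> \<eta>" "\<eta> \<le> \<delta>" "real (card I) * \<eta> powr s \<le> \<epsilon>"
    using cover[OF pos] by (elim exE conjE) (rule that; (assumption | blast))
  obtain h where h: "bij_betw h {0..<card I} I"
    using ex_bij_betw_nat_finite[OF I(1)] by blast
  have hI: "h n \<in> I" if "n < card I" for n using h that by (auto simp: bij_betw_def)
  define V where "V n = (if n < card I then U (h n) else {})" for n
  have "A \<subseteq> (\<Union>n. V n)"
  proof
    fix x assume "x \<in> A"
    then obtain i where i: "i \<in> I" "x \<in> U i" using I(2) by blast
    then obtain n where "n < card I" "i = h n"
      using bij_betw_imp_surj_on[OF h] by (metis atLeastLessThan_iff imageE)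
    then have "x \<in> V n" using i by (simp add: V_def)
    then show "x \<in> (\<Union>n. V n)" by blast
  qed
  moreover have "bounded (V n) \<and> diameter (V n) \<le> \<delta>" for n
    using I(3,4)[OF hI, of n] I(6) pos by (auto simp: V_def)
  moreover have "suminf (\<lambda>n. hausdorff_gauge s (V n)) \<le> ennreal \<epsilon>"
  proof -
    have "suminf (\<lambda>n. hausdorff_gauge s (V n)) = (\<Sum>n<card I. hausdorff_gauge s (V n))"
      by (rule suminf_finite) (auto simp: V_def hausdorff_gauge_def)
    also have "\<dots> \<le> (\<Sum>n<card I. ennreal (\<eta> powr s))"
    proof (rule sum_mono)
      fix n assume "n \<in> {..<card I}"
      then have "V n = {} \<or> 0 \<le> diameter (V n) \<and> diameter (V n) \<le> \<eta>"
        using I(3,4)[OF hI, of n] by (auto simp: V_def intro: diameter_ge_0)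
      then show "hausdorff_gauge s (V n) \<le> ennreal (\<eta> powr s)"
        using s by (auto simp: hausdorff_gauge_def intro!: ennreal_leI powr_mono2)
    qed
    also have "\<dots> = ennreal (real (card I) * \<eta> powr s)"
      by (simp add: ennreal_mult' ennreal_of_nat_eq_real_of_nat)
    also have "\<dots> \<le> ennreal \<epsilon>" using I(7) by (rule ennreal_leI)
    finally show ?thesis .
  qed
  ultimately show "\<exists>U :: nat \<Rightarrow> 'a set. A \<subseteq> (\<Union>i. U i) \<and>
      (\<forall>i. bounded (U i) \<and> diameter (U i) \<le> \<delta>) \<and> suminf (\<lambda>i. hausdorff_gauge s (U i)) \<le> ennreal \<epsilon>"
    by blast
qed

text \<open>\<open>A\<close> is the Lipschitz image of its projection to the coordinates in \<open>F\<close>; the covers come from a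
  grid in these coordinates.\<close>

lemma hausdorff_null_lipschitz_graph:
  fixes A :: "(real^'i::finite) set"
  assumes s: "s > real (card F)"
    and bdd: "\<And>x j. x \<in> A \<Longrightarrow> j \<in> F \<Longrightarrow> \<bar>x $ j\<bar> \<le> M"
    and lip: "\<And>a b \<eta>. a \<in> A \<Longrightarrow> b \<in> A \<Longrightarrow> 0 \<le> \<eta> \<Longrightarrow> (\<And>j. j \<in> F \<Longrightarrow> \<bar>a $ j - b $ j\<bar> \<le> \<eta>) \<Longrightarrow> norm (a - b) \<le> L * \<eta>"
    and L: "L > 0"
  shows "hausdorff_measure s A = 0"
proof (rule hausdorff_null_finite_covers)
  show "s > 0" using s by linarith
  fix \<delta> \<epsilon> :: real assume pos: "\<delta> > 0" "\<epsilon> > 0"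
  \<comment> \<open>The added 1 gives \<open>K \<ge> 1\<close> even for \<open>M \<le> 0\<close>, so
    that later \<open>2 * K * n + 1 \<le> 3 * K * n\<close>.\<close>
  define K where "K = nat \<lceil>M\<rceil> + 1"
  have K: "M \<le> real K" "K \<ge> 1" by (auto simp: K_def) linarith
  define d where "d = card F"
  \<comment> \<open>A grid of mesh \<open>1 / n\<close> has at most \<open>(3 * K * n) ^ d\<close>
    cells in the box, each holding a piece of diameter at most \<open>L / n\<close>. This expression
    bounds the cost and tends to 0 because \<open>d < s\<close>.\<close>
  have "((\<lambda>n. (3 * real K) ^ d * L powr s * real n powr (real d - s)) \<longlongrightarrow> (3 * real K) ^ d * L powr s * 0) sequentially"
    using s by (intro tendsto_mult_left tendsto_neg_powr filterlim_real_sequentially) (simp add: d_def)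
  then have "eventually (\<lambda>n. (3 * real K) ^ d * L powr s * real n powr (real d - s) < \<epsilon>) sequentially"
    using pos by (intro order_tendstoD(2)) auto
  moreover have "eventually (\<lambda>n. real n > L / \<delta>) sequentially"
    using filterlim_real_sequentially by (auto simp: filterlim_at_top_dense)
  moreover have "eventually (\<lambda>n::nat. n \<ge> 1) sequentially"
    by (rule eventually_ge_at_top)
  ultimately have "eventually (\<lambda>n. (3 * real K) ^ d * L powr s * real n powr (real d - s) < \<epsilon> \<and>
      real n > L / \<delta> \<and> n \<ge> 1) sequentially"
    by eventually_elim auto
  then obtain n :: nat where n: "(3 * real K) ^ d * L powr s * real n powr (real d - s) < \<epsilon>"
      "real n > L / \<delta>" "n \<ge> 1"
    by (auto simp: eventually_sequentially)
  define I where "I = PiE F (\<lambda>_. {- int (K * n)..int (K * n)})"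
  define U where "U k = {x \<in> A. \<forall>j\<in>F. \<lfloor>real n * x $ j\<rfloor> = k j}" for k
  have finI: "finite I" by (auto simp: I_def intro!: finite_PiE)
  have diam: "norm (a - b) \<le> L / real n" if "a \<in> U k" "b \<in> U k" for a b k
  proof -
    have "norm (a - b) \<le> L * (1 / real n)"
    proof (rule lip)
      show "\<bar>a $ j - b $ j\<bar> \<le> 1 / real n" if "j \<in> F" for j
      proof -
        have "\<lfloor>real n * a $ j\<rfloor> = \<lfloor>real n * b $ j\<rfloor>"
          using \<open>a \<in> U k\<close> \<open>b \<in> U k\<close> that by (simp add: U_def)
        then have "\<bar>real n * a $ j - real n * b $ j\<bar> \<le> 1" by linarith
        then have "real n * \<bar>a $ j - b $ j\<bar> \<le> 1"
          by (simp add: abs_mult flip: right_diff_distrib)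
        then show ?thesis using n(3) by (simp add: field_simps)
      qed
    qed (use that in \<open>auto simp: U_def\<close>)
    then show ?thesis by simp
  qed
  have "A \<subseteq> (\<Union>k\<in>I. U k)"
  proof
    fix x assume x: "x \<in> A"
    define k where "k = restrict (\<lambda>j. \<lfloor>real n * x $ j\<rfloor>) F"
    have "\<lfloor>real n * x $ j\<rfloor> \<in> {- int (K * n)..int (K * n)}" if "j \<in> F" for j
    proof -
      have "\<bar>real n * x $ j\<bar> \<le> real (K * n)"
        using mult_left_mono[of "\<bar>x $ j\<bar>" "real K" "real n"] bdd[OF x that] K
        by (simp add: abs_mult algebra_simps)
      then show ?thesis by (simp add: le_floor_iff floor_le_iff) linarith
    qed
    then have "k \<in> I" by (auto simp: I_def k_def)
    moreover have "x \<in> U k" using x by (simp add: U_def k_def)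
    ultimately show "x \<in> (\<Union>k\<in>I. U k)" by blast
  qed
  moreover have "bounded (U k) \<and> diameter (U k) \<le> L / real n" for k
  proof
    show "bounded (U k)"
      unfolding bounded_two_points dist_norm using diam by blast
    show "diameter (U k) \<le> L / real n"
      using diam L by (intro diameter_le) auto
  qed
  moreover have "L / real n \<le> \<delta>"
    using n pos L by (simp add: field_simps)
  moreover have "real (card I) * (L / real n) powr s \<le> \<epsilon>"
  proof -
    have "card I = (2 * (K * n) + 1) ^ d"
      by (simp add: I_def card_PiE d_def nat_add_distrib nat_mult_distrib)
    also have "\<dots> \<le> (3 * (K * n)) ^ d"
      using K n(3) by (intro power_mono) (simp_all add: Suc_le_eq)
    finally have "real (card I) \<le> real ((3 * (K * n)) ^ d)" by (simp only: of_nat_le_iff)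
    also have "\<dots> = (3 * real K) ^ d * real n powr real d"
      using n(3) by (simp add: power_mult_distrib powr_realpow)
    finally have "real (card I) * (L / real n) powr s \<le> (3 * real K) ^ d * real n powr real d * (L / real n) powr s"
      by (rule mult_right_mono) simp
    also have "\<dots> = (3 * real K) ^ d * L powr s * real n powr (real d - s)"
      using L n(3) by (simp add: powr_divide powr_diff)
    finally show ?thesis using n(1) by linarith
  qed
  ultimately show "\<exists>(I :: ('i \<Rightarrow> int) set) U \<eta>. finite I \<and> A \<subseteq> (\<Union>i\<in>I. U i) \<and>
      (\<forall>i\<in>I. bounded (U i) \<and> diameter (U i) \<le> \<eta>) \<and> 0 \<le> \<eta> \<and> \<eta> \<le> \<delta> \<and> real (card I) * \<eta> powr s \<le> \<epsilon>"
    using finI L by (intro exI[of _ I] exI[of _ U] exI[of _ "L / real n"]) auto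
qed

section \<open>Partial derivatives and regular zeros\<close>

lemma poly_deg_partial:
  assumes "poly_deg E n f"
  shows "\<exists>f'. poly_deg E (n - 1) f' \<and>
    (\<forall>x t. ((\<lambda>t. f (x + t *\<^sub>R axis i 1)) has_real_derivative f' (x + t *\<^sub>R axis i 1)) (at t))"
  using assms
proof (induction rule: poly_deg.induct)
  case (const n c)
  show ?case by (intro exI[of _ "\<lambda>_. 0"]) (auto intro: poly_deg.const)
next
  case (coord n f j)
  then obtain f' where f': "poly_deg E (n - 1) f'"
      "\<And>x t. ((\<lambda>t. f (x + t *\<^sub>R axis i 1)) has_real_derivative f' (x + t *\<^sub>R axis i 1)) (at t)"
    by blast
  let ?g = "\<lambda>x. (if i = j then 1 else 0) * f x + x $ j * f' x"
  have "poly_deg E n (\<lambda>x. x $ j * f' x)"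
  \<comment> \<open>At \<open>n = 0\<close> the bound \<open>n - 1\<close> truncates, and
    multiplying by a coordinate would exceed it. But then \<open>f\<close> is constant and
    \<open>f'\<close> vanishes.\<close>
  proof (cases n)
    case 0
    then obtain c where c: "f = (\<lambda>_. c)" using poly_deg_0 coord by blast
    have "f' x = 0" for x
      using f'(2)[of x 0] DERIV_unique[of "\<lambda>_. c" "f' x" 0 0] by (simp add: c)
    then show ?thesis by (simp add: poly_deg.const)
  next
    case (Suc m)
    then show ?thesis using poly_deg.coord[OF f'(1)] coord by auto
  qed
  then have "poly_deg E n ?g"
    by (rule poly_deg.add[OF poly_deg_scale[OF coord.hyps(1)]])
  then have "poly_deg E (Suc n - 1) ?g"
    unfolding diff_Suc_1 .
  moreover have "((\<lambda>t. (x + t *\<^sub>R axis i 1) $ j * f (x + t *\<^sub>R axis i 1)) has_real_derivative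
      ?g (x + t *\<^sub>R axis i 1)) (at t)" for x t
  proof -
    have "((\<lambda>t. (x + t *\<^sub>R axis i 1) $ j) has_real_derivative (if i = j then 1 else 0)) (at t)"
      by (auto simp: axis_def intro!: derivative_eq_intros)
    from DERIV_mult[OF this f'(2)[of x t]] show ?thesis
      by (simp add: algebra_simps)
  qed
  ultimately show ?case by (intro exI[of _ ?g]) simp
next
  case (add n f g)
  then obtain f' g' where "poly_deg E (n - 1) f'" "poly_deg E (n - 1) g'"
      "\<And>x t. ((\<lambda>t. f (x + t *\<^sub>R axis i 1)) has_real_derivative f' (x + t *\<^sub>R axis i 1)) (at t)"
      "\<And>x t. ((\<lambda>t. g (x + t *\<^sub>R axis i 1)) has_real_derivative g' (x + t *\<^sub>R axis i 1)) (at t)"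
    by blast
  then show ?case
    by (intro exI[of _ "\<lambda>x. f' x + g' x"]) (auto intro: poly_deg.add DERIV_add)
qed

lemma poly_deg_continuous: "poly_deg E n f \<Longrightarrow> continuous_on S f"
  by (induction rule: poly_deg.induct) (auto intro!: continuous_on_add continuous_on_mult continuous_on_component continuous_on_const continuous_on_id)

text \<open>The bound \<open>C\<close> is carried along because the Lipschitz constant of a product
  involves bounds on the factors.\<close>

lemma poly_deg_lipschitz:
  assumes "poly_deg E n f" "R \<ge> 0"
  shows "\<exists>C K. C \<ge> 0 \<and> K \<ge> 0 \<and> (\<forall>x\<in>cball 0 R. \<bar>f x\<bar> \<le> C) \<and>
    (\<forall>x\<in>cball 0 R. \<forall>y\<in>cball 0 R. \<bar>f x - f y\<bar> \<le> K * norm (x - y))"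
  using assms(1)
proof (induction rule: poly_deg.induct)
  case (const n c)
  show ?case by (rule exI[of _ "\<bar>c\<bar>"]) auto
next
  case (coord n f i)
  then obtain C K where CK: "C \<ge> 0" "K \<ge> 0" "\<And>x. x \<in> cball 0 R \<Longrightarrow> \<bar>f x\<bar> \<le> C"
    "\<And>x y. x \<in> cball 0 R \<Longrightarrow> y \<in> cball 0 R \<Longrightarrow> \<bar>f x - f y\<bar> \<le> K * norm (x - y)" by blast
  have nth: "\<bar>x $ i\<bar> \<le> R" if "x \<in> cball 0 R" for x :: "real^'a"
    using that component_le_norm_cart[of x i] by simp
  have "\<bar>x $ i * f x\<bar> \<le> R * C" if "x \<in> cball 0 R" for x
    using nth[OF that] CK(3)[OF that] assms(2) by (simp add: abs_mult mult_mono)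
  moreover have "\<bar>x $ i * f x - y $ i * f y\<bar> \<le> (R * K + C) * norm (x - y)"
    if x: "x \<in> cball 0 R" and y: "y \<in> cball 0 R" for x y
  proof -
    have "x $ i * f x - y $ i * f y = x $ i * (f x - f y) + (x - y) $ i * f y"
      by (simp add: algebra_simps)
    then have "\<bar>x $ i * f x - y $ i * f y\<bar> \<le> \<bar>x $ i\<bar> * \<bar>f x - f y\<bar> + \<bar>(x - y) $ i\<bar> * \<bar>f y\<bar>"
      using abs_triangle_ineq[of "x $ i * (f x - f y)" "(x - y) $ i * f y"] by (simp only: abs_mult)
    also have "\<dots> \<le> R * (K * norm (x - y)) + norm (x - y) * C"
      using nth[OF x] CK(4)[OF x y] CK(3)[OF y] component_le_norm_cart[of "x - y" i] assms(2)
      by (intro add_mono mult_mono) auto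
    finally show ?thesis by (simp add: algebra_simps)
  qed
  ultimately show ?case
    using CK(1,2) assms(2) by (intro exI[of _ "R * C"] exI[of _ "R * K + C"]) auto
next
  case (add n f g)
  then obtain C K C' K' where 1: "C \<ge> 0" "K \<ge> 0" "\<forall>x\<in>cball 0 R. \<bar>f x\<bar> \<le> C"
    "\<forall>x\<in>cball 0 R. \<forall>y\<in>cball 0 R. \<bar>f x - f y\<bar> \<le> K * norm (x - y)"
    and 2: "C' \<ge> 0" "K' \<ge> 0" "\<forall>x\<in>cball 0 R. \<bar>g x\<bar> \<le> C'"
    "\<forall>x\<in>cball 0 R. \<forall>y\<in>cball 0 R. \<bar>g x - g y\<bar> \<le> K' * norm (x - y)" by blast
  have "\<bar>f x + g x\<bar> \<le> C + C'" if "x \<in> cball 0 R" for x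
    using 1(3) 2(3) that by (smt (verit))
  moreover have "\<bar>(f x + g x) - (f y + g y)\<bar> \<le> (K + K') * norm (x - y)"
    if "x \<in> cball 0 R" "y \<in> cball 0 R" for x y
    using 1(4)[rule_format, OF that] 2(4)[rule_format, OF that] unfolding distrib_right by linarith
  ultimately show ?case
    using 1(1,2) 2(1,2) by (intro exI[of _ "C + C'"] exI[of _ "K + K'"]) auto
qed

lemma mean_value_from_0:
  fixes g g' :: "real \<Rightarrow> real"
  assumes "\<And>t. (g has_real_derivative g' t) (at t)"
  obtains \<theta> where "\<bar>\<theta>\<bar> \<le> \<bar>t\<bar>" "g t - g 0 = t * g' \<theta>"
proof (cases t "0::real" rule: linorder_cases)
  case less
  then obtain z where "t < z" "z < 0" "g 0 - g t = (0 - t) * g' z"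
    using MVT2[of t 0 g g'] assms by blast
  then show ?thesis using that[of z] by (simp add: algebra_simps)
next
  case greater
  then obtain z where "0 < z" "z < t" "g t - g 0 = (t - 0) * g' z"
    using MVT2[of 0 t g g'] assms by blast
  then show ?thesis using that[of z] by simp
qed (use that[of 0] in simp)

text \<open>No implicit function is constructed: for two nearby zeros, the mean value theorem along
  axis \<open>i\<close> bounds the difference in coordinate \<open>i\<close> by the differences in
  the others.\<close>

lemma hausdorff_null_regular_zeros:
  fixes f f' :: "real^'i::finite \<Rightarrow> real"
  assumes f: "poly_deg E n f" and f': "poly_deg E m f'" and i: "i \<in> E"
    and deriv: "\<And>x t. ((\<lambda>t. f (x + t *\<^sub>R axis i 1)) has_real_derivative f' (x + t *\<^sub>R axis i 1)) (at t)"
    and s: "s > real (card E) - 1"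
  shows "hausdorff_measure s {x \<in> functions_on E. f x = 0 \<and> f' x \<noteq> 0} = 0"
proof (rule hausdorff_null_locally)
  fix z assume "z \<in> {x \<in> functions_on E. f x = 0 \<and> f' x \<noteq> 0}"
  then have z: "f' z \<noteq> 0" by simp
  define c where "c = \<bar>f' z\<bar> / 2"
  have c: "c > 0" using z by (simp add: c_def)
  have "isCont f' z"
    using poly_deg_continuous[OF f', of UNIV] by (simp add: continuous_on_eq_continuous_at)
  then obtain r where r: "r > 0" "\<And>x. dist x z < r \<Longrightarrow> dist (f' x) (f' z) < c"
    using c unfolding continuous_at_eps_delta by blast
  have low: "c \<le> \<bar>f' x\<bar>" if "dist x z < r" for x
    using r(2)[OF that] by (auto simp: c_def dist_real_def abs_if split: if_splits)
  define R where "R = norm z + r"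
  obtain K where K: "K \<ge> 0" "\<And>x y. x \<in> cball 0 R \<Longrightarrow> y \<in> cball 0 R \<Longrightarrow> \<bar>f x - f y\<bar> \<le> K * norm (x - y)"
    using poly_deg_lipschitz[OF f, of R] r(1) by (auto simp: R_def)
  have R: "x \<in> cball 0 R" if "dist x z < r" for x
    using that norm_triangle_ineq[of z "x - z"] by (simp add: R_def dist_norm)
  define N where "N = real (card E)"
  have N: "N > 0" using i by (auto simp: N_def card_gt_0_iff)
  \<comment> \<open>\<open>N\<close> accounts for the coordinates other than \<open>i\<close>, and
    \<open>K * N / c\<close> for coordinate \<open>i\<close>.\<close>
  define L where "L = N + K * N / c"
  \<comment> \<open>With radius \<open>r / 3\<close>, moving a point of \<open>?A\<close> along axis
    \<open>i\<close> to the \<open>i\<close>-th coordinate of another stays within \<open>r\<close>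
    of \<open>z\<close>.\<close>
  let ?A = "{x \<in> functions_on E. f x = 0 \<and> f' x \<noteq> 0} \<inter> ball z (r / 3)"
  have "hausdorff_measure s ?A = 0"
  proof (rule hausdorff_null_lipschitz_graph)
    show "s > real (card (E - {i}))"
      using s i N by (simp add: N_def card_Diff_singleton of_nat_diff)
    show "L > 0" using N K c by (simp add: L_def add_pos_nonneg)
    show "\<bar>x $ j\<bar> \<le> R" if "x \<in> ?A" for x j
      using that R[of x] r(1) component_le_norm_cart[of x j] by (auto simp: dist_commute)
    fix a b \<eta> assume a: "a \<in> ?A" and b: "b \<in> ?A" and \<eta>: "0 \<le> \<eta>"
      and close: "\<And>j. j \<in> E - {i} \<Longrightarrow> \<bar>a $ j - b $ j\<bar> \<le> \<eta>"
    define t where "t = a $ i - b $ i"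
    \<comment> \<open>\<open>a'\<close> takes coordinate \<open>i\<close> from \<open>a\<close> and
      the others from \<open>b\<close>. As \<open>a\<close> and \<open>b\<close> are zeros,
      \<open>f a'\<close> is at least \<open>\<bar>t\<bar> * c\<close> in absolute value by the
      slope, and at most \<open>K * norm (a' - a)\<close>.\<close>
    define a' where "a' = b + t *\<^sub>R axis i 1"
    have zero: "a $ j = 0" "b $ j = 0" if "j \<notin> E" for j
      using a b that by (auto simp: functions_on_def)
    have da: "dist a z < r / 3" and db: "dist b z < r / 3"
      using a b by (auto simp: dist_commute)
    have "norm (a - b) < 2 * (r / 3)"
      using dist_triangle2[of a b z] da db by (simp add: dist_norm)
    then have t: "\<bar>t\<bar> < 2 * (r / 3)"
      using component_le_norm_cart[of "a - b" i] by (simp add: t_def)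
    have near: "dist (b + \<theta> *\<^sub>R axis i 1) z < r" if "\<bar>\<theta>\<bar> \<le> \<bar>t\<bar>" for \<theta>
    proof -
      have "norm (b - z + \<theta> *\<^sub>R axis i 1) \<le> norm (b - z) + \<bar>\<theta>\<bar>"
        using norm_triangle_ineq[of "b - z" "\<theta> *\<^sub>R axis i 1"] by simp
      then show ?thesis using db t that by (simp add: dist_norm algebra_simps)
    qed
    obtain \<theta> where \<theta>: "\<bar>\<theta>\<bar> \<le> \<bar>t\<bar>" "f a' - f b = t * f' (b + \<theta> *\<^sub>R axis i 1)"
      using mean_value_from_0[OF deriv[of b], of t] by (auto simp: a'_def)
    have "\<bar>t\<bar> * c \<le> \<bar>t\<bar> * \<bar>f' (b + \<theta> *\<^sub>R axis i 1)\<bar>"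
      using low[OF near[OF \<theta>(1)]] by (simp add: mult_left_mono)
    also have "\<dots> = \<bar>f a' - f a\<bar>"
      using \<theta>(2) a b by (simp flip: abs_mult)
    also have "\<dots> \<le> K * norm (a' - a)"
      using R[of a] R[of a'] near[of t] da r(1) by (intro K(2)) (auto simp: a'_def)
    also have "norm (a' - a) \<le> N * \<eta>"
    proof -
      have "norm (a' - a) \<le> (\<Sum>j\<in>UNIV. \<bar>(a' - a) $ j\<bar>)" by (rule norm_le_l1_cart)
      also have "\<dots> = (\<Sum>j\<in>E. \<bar>(a' - a) $ j\<bar>)"
        using zero i by (intro sum.mono_neutral_right) (auto simp: a'_def axis_def)
      also have "\<dots> \<le> (\<Sum>j\<in>E. \<eta>)"
      proof (rule sum_mono)
        fix j assume "j \<in> E"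
        then show "\<bar>(a' - a) $ j\<bar> \<le> \<eta>"
          using close[of j] \<eta> by (cases "j = i") (auto simp: a'_def t_def axis_def abs_minus_commute)
      qed
      finally show ?thesis by (simp add: N_def)
    qed
    finally have "\<bar>t\<bar> * c \<le> K * (N * \<eta>)" using K(1) by (simp add: mult_left_mono)
    then have tt: "\<bar>t\<bar> \<le> K * N / c * \<eta>" using c by (simp add: field_simps)
    have "norm (a - b) \<le> (\<Sum>j\<in>UNIV. \<bar>(a - b) $ j\<bar>)" by (rule norm_le_l1_cart)
    also have "\<dots> = (\<Sum>j\<in>E. \<bar>(a - b) $ j\<bar>)"
      using zero by (intro sum.mono_neutral_right) auto
    also have "\<dots> = \<bar>t\<bar> + (\<Sum>j\<in>E - {i}. \<bar>(a - b) $ j\<bar>)"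
      using i by (simp add: sum.remove t_def)
    also have "(\<Sum>j\<in>E - {i}. \<bar>(a - b) $ j\<bar>) \<le> (\<Sum>j\<in>E - {i}. \<eta>)"
      using close by (intro sum_mono) auto
    also have "(\<Sum>j\<in>E - {i}. \<eta>) \<le> N * \<eta>"
      using \<eta> by (simp add: N_def mult_right_mono card_Diff1_le)
    finally show "norm (a - b) \<le> L * \<eta>" using tt by (simp add: L_def distrib_right)
  qed
  then show "\<exists>r>0. hausdorff_measure s ({x \<in> functions_on E. f x = 0 \<and> f' x \<noteq> 0} \<inter> ball z r) = 0"
    using r(1) by (intro exI[of _ "r / 3"]) simp
qed

text \<open>The point \<open>x\<close> is reached from 0 by changing one coordinate at a time inside
  \<open>functions_on E\<close>.\<close>

lemma constant_if_partials_vanish: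
  fixes f :: "real^'i::finite \<Rightarrow> real"
  assumes deriv: "\<And>i x t. i \<in> E \<Longrightarrow> x \<in> functions_on E \<Longrightarrow>
      ((\<lambda>t. f (x + t *\<^sub>R axis i 1)) has_real_derivative 0) (at t)"
    and x: "x \<in> functions_on E"
  shows "f x = f 0"
proof -
  have "f (\<Sum>i\<in>F. x $ i *\<^sub>R axis i 1) = f 0" if "F \<subseteq> E" for F
    using finite[of F] that
  proof (induction F rule: finite_induct)
    case (insert i F)
    let ?y = "\<Sum>i\<in>F. x $ i *\<^sub>R axis i 1"
    have "?y \<in> functions_on E"
      using insert.prems by (auto simp: functions_on_def axis_def intro!: sum.neutral)
    then have "f (?y + x $ i *\<^sub>R axis i 1) = f (?y + 0 *\<^sub>R axis i 1)"
      using insert.prems by (intro DERIV_isconst_all) (auto intro: deriv)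
    then show ?case using insert by (simp add: add.commute)
  qed simp
  from this[of E] show ?thesis
  proof -
    have "(\<Sum>i\<in>E. x $ i *\<^sub>R axis i 1) = (\<Sum>i\<in>UNIV. x $ i *\<^sub>R axis i (1::real))"
      using x by (intro sum.mono_neutral_left) (auto simp: functions_on_def)
    also have "\<dots> = x" using basis_expansion[of x] by (simp add: scalar_mult_eq_scaleR)
    finally show ?thesis using \<open>E \<subseteq> E \<Longrightarrow> _\<close> by simp
  qed
qed

lemma hausdorff_null_polynomial_zeros:
  fixes f :: "real^'i::finite \<Rightarrow> real"
  assumes "poly_deg E n f" "\<exists>x\<in>functions_on E. f x \<noteq> 0" "s > real (card E) - 1"
  shows "hausdorff_measure s {x \<in> functions_on E. f x = 0} = 0"
  using assms(1,2)
proof (induction n arbitrary: f)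
  case 0
  then have "{x \<in> functions_on E. f x = 0} = {}" using poly_deg_0 by force
  then show ?case by (simp only: hausdorff_null_empty)
next
  case (Suc n)
  have "\<forall>i. \<exists>f'. poly_deg E n f' \<and>
    (\<forall>x t. ((\<lambda>t. f (x + t *\<^sub>R axis i 1)) has_real_derivative f' (x + t *\<^sub>R axis i 1)) (at t))"
    using poly_deg_partial[OF Suc.prems(1)] by simp
  then obtain D where D: "\<And>i. poly_deg E n (D i)"
    "\<And>i x t. ((\<lambda>t. f (x + t *\<^sub>R axis i 1)) has_real_derivative D i (x + t *\<^sub>R axis i 1)) (at t)"
    by metis
  show ?case
  \<comment> \<open>A zero of \<open>f\<close> is either regular in direction \<open>i\<close> or a
    zero of \<open>D i\<close>, to which the induction hypothesis applies. If all partial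
    derivatives vanish on \<open>functions_on E\<close>, then \<open>f\<close> is a nonzero constant
    there.\<close>
  proof (cases "\<exists>i\<in>E. \<exists>x\<in>functions_on E. D i x \<noteq> 0")
    case True
    then obtain i where i: "i \<in> E" "\<exists>x\<in>functions_on E. D i x \<noteq> 0" by blast
    have "hausdorff_measure s ({x \<in> functions_on E. f x = 0 \<and> D i x \<noteq> 0}
        \<union> {x \<in> functions_on E. D i x = 0}) = 0"
      by (intro hausdorff_null_Un Suc.IH D(1) i(2)
          hausdorff_null_regular_zeros[OF Suc.prems(1) D(1) i(1) D(2) assms(3)])
    then show ?thesis by (rule hausdorff_null_mono) auto
  next
    case False
    have "f x = f 0" if x: "x \<in> functions_on E" for x
    proof (rule constant_if_partials_vanish[OF _ x])
      fix i and y :: "real^'i" and t assume iy: "i \<in> E" "y \<in> functions_on E"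
      then have "y + t *\<^sub>R axis i 1 \<in> functions_on E" by (auto simp: functions_on_def axis_def)
      then show "((\<lambda>t. f (y + t *\<^sub>R axis i 1)) has_real_derivative 0) (at t)"
        using D(2)[of y i t] False iy(1) by fastforce
    qed
    then have "{x \<in> functions_on E. f x = 0} = {}" using Suc.prems(2) by force
    then show ?thesis by (simp only: hausdorff_null_empty)
  qed
qed

lemma hausdorff_dim_polynomial_zeros:
  fixes f :: "real^'i::finite \<Rightarrow> real"
  assumes f: "poly_deg E n f" "\<exists>x\<in>functions_on E. f x \<noteq> 0"
    and A: "A \<subseteq> {x \<in> functions_on E. f x = 0}"
  shows "hausdorff_dim A \<le> ereal (real (card E) - 1)"
proof (cases "A = {}")
  case False
  \<comment> \<open>For empty \<open>E\<close> only the zero vector remains and \<open>f\<close> is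
    nonzero there, so \<open>A\<close> would be empty. Hence \<open>card E \<ge> 1\<close>, which
    makes the exponents below nonnegative, as \<open>hausdorff_dim\<close> demands.\<close>
  have "E \<noteq> {}"
  proof
    assume "E = {}"
    then have "x = 0" if "x \<in> functions_on E" for x :: "real^'i"
      using that by (simp add: functions_on_def vec_eq_iff)
    then show False using f(2) A False by blast
  qed
  then have "card E \<ge> 1" by (simp add: Suc_le_eq card_gt_0_iff)
  show ?thesis
  proof (rule ereal_le_epsilon2)
    fix e :: real assume "0 < e"
    then have "hausdorff_measure (real (card E) - 1 + e) A = 0"
      by (intro hausdorff_null_mono[OF hausdorff_null_polynomial_zeros[OF f] A]) simp
    then have "hausdorff_dim A \<le> ereal (real (card E) - 1 + e)"
      using False \<open>0 < e\<close> \<open>card E \<ge> 1\<close> unfolding hausdorff_dim_def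
      by (auto intro!: Inf_lower exI[of _ "real (card E) - 1 + e"])
    then show "hausdorff_dim A \<le> ereal (real (card E) - 1) + ereal e" by simp
  qed
qed (simp add: hausdorff_dim_def)

subsection \<open>Exceptional weights\<close>

theorem mainTheorem2:
  fixes E :: "'v::finite set set" and B :: "'v set"
  assumes "simple_graph E"
    and "connected_graph E"
    and "B \<noteq> {}"
  shows "(\<forall>w \<in> weights E. eigenfunctions_nonvanishing E B w \<longrightarrow> all_eigenvalues_simple E B w)
    \<and> (\<forall>w \<in> weights E. \<forall>\<mu>. dim (steklov_eigenspace E B w \<mu>) > 1 \<longrightarrow>
         (\<forall>x\<in>B. \<exists>f \<in> steklov_eigenspace E B w \<mu>. f \<noteq> 0 \<and> f $ x = 0))
    \<and> (\<exists>p :: ('v set) real_mpoly. mpoly_vars p \<subseteq> E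
         \<and> (\<exists>x \<in> functions_on E. mpoly_eval p x \<noteq> 0)
         \<and> exceptional_weights E B \<subseteq> {x \<in> functions_on E. mpoly_eval p x = 0})
    \<and> hausdorff_dim (exceptional_weights E B) \<le> ereal (real (card E) - 1)"
proof -
  have w: "w \<in> functions_on E" if "w \<in> weights E" for w
    using that by (simp add: weights_def)
  note det = det_dirichlet_matrix_weights[OF assms(2,3)]
  have vanish: "\<exists>f \<in> steklov_eigenspace E B w \<mu>. f \<noteq> 0 \<and> f $ x = 0"
    if "w \<in> weights E" "dim (steklov_eigenspace E B w \<mu>) > 1" for w \<mu> x
    using subspace_steklov_eigenspace[OF w[OF that(1)] det[OF that(1)]] that(2)
    by (rule eigenspace_vanishing_element)
  have simple: "all_eigenvalues_simple E B w"
    if "w \<in> weights E" "eigenfunctions_nonvanishing E B w" for w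
    unfolding all_eigenvalues_simple_def
  proof (intro allI impI)
    fix \<mu> assume "steklov_eigenvalue E B w \<mu>"
    then have "\<not> steklov_eigenspace E B w \<mu> \<subseteq> {0}"
      by (auto simp: steklov_eigenvalue_def)
    then have "dim (steklov_eigenspace E B w \<mu>) \<noteq> 0"
      by simp
    \<comment> \<open>Larger dimension would give an eigenfunction vanishing at any chosen vertex of
      \<open>B\<close>, which is nonempty.\<close>
    moreover have "\<not> dim (steklov_eigenspace E B w \<mu>) > 1"
      using vanish[OF that(1)] that(2) assms(3)
      unfolding eigenfunctions_nonvanishing_def steklov_eigenfunction_def by blast
    ultimately show "dim (steklov_eigenspace E B w \<mu>) = 1" by linarith
  qed
  have "\<forall>x\<in>B. \<exists>n. \<exists>w\<in>functions_on E. det (krylov_gram B x n w) \<noteq> 0"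
    using exists_nonsingular_krylov_gram[OF assms(2)] by metis
  then obtain N where N: "\<And>x. x \<in> B \<Longrightarrow> \<exists>w\<in>functions_on E. det (krylov_gram B x (N x) w) \<noteq> 0"
    by metis
  \<comment> \<open>The number of Krylov vectors depends on \<open>x\<close>; the product detects,
    at positive weights, an eigenfunction vanishing at any vertex of \<open>B\<close>.\<close>
  define Q where "Q w = (\<Prod>x\<in>B. det (krylov_gram B x (N x) w))" for w
  have "real_polynomial_function Q"
    unfolding Q_def by (intro real_polynomial_function_prod real_polynomial_function_krylov_gram) auto
  then obtain d g where g: "poly_deg E d g" "\<forall>w\<in>functions_on E. Q w = g w"
    using real_polynomial_function_imp_poly_deg by blast
  obtain z where "z \<in> functions_on E" "Q z \<noteq> 0"
    using real_polynomial_function_prod_nonzero[where A = B and S = "functions_on E"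
        and F = "\<lambda>x w. det (krylov_gram B x (N x) w)", OF finite subspace_functions_on
        real_polynomial_function_krylov_gram N]
    unfolding Q_def by blast
  then have g_nz: "\<exists>x\<in>functions_on E. g x \<noteq> 0"
    using g(2) by force
  have exceptional: "exceptional_weights E B \<subseteq> {x \<in> functions_on E. g x = 0}"
  proof
    fix v assume v: "v \<in> exceptional_weights E B"
    then have vE: "v \<in> weights E" by (simp add: exceptional_weights_def)
    \<comment> \<open>Nonvanishing already forces simplicity, so at an exceptional weight it is
      nonvanishing that fails.\<close>
    have "\<not> eigenfunctions_nonvanishing E B v"
      using v simple by (auto simp: exceptional_weights_def)
    then obtain f x where "steklov_eigenfunction E B v f" "x \<in> B" "f $ x = 0"
      by (auto simp: eigenfunctions_nonvanishing_def)
    then have "Q v = 0"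
      using krylov_gram_singular[OF w[OF vE] det[OF vE]] by (auto simp: Q_def)
    then show "v \<in> {x \<in> functions_on E. g x = 0}"
      using g(2) w[OF vE] by simp
  qed
  obtain p where p: "mpoly_vars p \<subseteq> E" "\<And>x. mpoly_eval p x = g x"
    using poly_deg_imp_mpoly[OF g(1)] by blast
  have "hausdorff_dim (exceptional_weights E B) \<le> ereal (real (card E) - 1)"
    by (rule hausdorff_dim_polynomial_zeros[OF g(1) g_nz exceptional])
  moreover have "\<exists>p :: ('v set) real_mpoly. mpoly_vars p \<subseteq> E
         \<and> (\<exists>x \<in> functions_on E. mpoly_eval p x \<noteq> 0)
         \<and> exceptional_weights E B \<subseteq> {x \<in> functions_on E. mpoly_eval p x = 0}"
    using p g_nz exceptional by (intro exI[of _ p]) simp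
  ultimately show ?thesis using vanish simple by blast
qed

end
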